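(* Let $d=1$, let $N\ge1$ be an integer, let $\Omega\in\mathbb C$ with $\operatorname{Im}\Omega>0$, and let $\{(k_j,l_j)\}_{j=1}^K\subseteq I_N^2$ be a set of $K$ distinct points. If $K>N$, the points $\{(k_j,l_j)\}_{j=1}^K$ induce a Gabor frame for the discrete Gabor transform on $\mathbb C^N$ with window $h_N^{\Omega/N}$. If $K<N$, they do not induce a frame. If $K=N$, they induce a frame precisely when the following condition is not fulfilled: for any $z_1,z_2,z_3,z_4\in\mathbb Z$, the number $$\left(\operatorname{Re}\Omega\cdot z_3+z_4\right)\sum_{j=1}^N\left(k_j-\tfrac N2+z_1\right)-\left(\operatorname{Re}\Omega\sum_{j=1}^N\left(k_j-\tfrac N2+z_1\right)+\sum_{j=1}^N\left(l_j-\tfrac N2+z_1\right)\right)z_3$$ is divisible by $N$ (i.e. is an integer multiple of $N$). If $\operatorname{Re}\Omega=0$, this condition reduces to: $N$ is even and $\sum_{j=1}^N(k_j,l_j)\in N\mathbb N\times N\mathbb N$.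
   Context: $I_N=\mathbb Z_N$, with representatives in $\{0,\dots,N-1\}$; $\mathbb N$ includes $0$. For $\mathbf f,\mathbf g\in\mathbb C^N$ (functions on $I_N$) and $k,l\in I_N$, the discrete Gabor transform is $$\mathbf V_{\mathbf g}\mathbf f[k,l]=\sum_{m\in I_N}\mathbf f[m]\,\overline{\mathbf g[m-k]}\,e^{-2\pi i\,lm/N}.$$ The window is $h_N^{\Omega/N}[n]=\sum_{k\in\mathbb Z}h_0^{\Omega/N}(n-kN)$, $n\in I_N$, where $h_0^{\Omega/N}(t)=\overline{e^{\pi i(\Omega/N)t^2}}$ for $t\in\mathbb R$. The points $\{(k_j,l_j)\}_{j=1}^K$ induce a Gabor frame for the discrete Gabor transform on $\mathbb C^N$ with window $h_N^{\Omega/N}$ if there exist $A,B>0$ such that for all $\mathbf f\in\mathbb C^N$, $A\|\mathbf f\|^2\le\sum_{j=1}^K|\mathbf V_{h_N^{\Omega/N}}\mathbf f[k_j,l_j]|^2\le B\|\mathbf f\|^2$, where $\|\cdot\|$ is the Euclidean norm. *)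

theory Defs
  imports "HOL-Analysis.Analysis"
begin

text \<open>
  \<open>\<int>\<^sub>N\<close> is represented by its residues \<open>0, \<dots>, N - 1\<close> of type \<^typ>\<open>int\<close>, and a vector in \<open>\<complex>\<^sup>N\<close> by a
  function \<^typ>\<open>int \<Rightarrow> complex\<close>, of which only the values on these residues are ever used.
\<close>

definition residues_set :: "nat \<Rightarrow> int set" where
  "residues_set N = {0..<int N}"

definition vec_norm :: "nat \<Rightarrow> (int \<Rightarrow> complex) \<Rightarrow> real" where
  "vec_norm N f = L2_set (\<lambda>m. cmod (f m)) (residues_set N)"

definition gabor_transform ::
    "nat \<Rightarrow> (int \<Rightarrow> complex) \<Rightarrow> (int \<Rightarrow> complex) \<Rightarrow> int \<Rightarrow> int \<Rightarrow> complex" where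
  "gabor_transform N g f k l =
     (\<Sum>m\<in>residues_set N. f m * cnj (g ((m - k) mod int N)) *
        exp (- (2 * of_real pi * \<i> * of_int (l * m) / of_nat N)))"

definition gauss :: "complex \<Rightarrow> real \<Rightarrow> complex" where
  "gauss w t = cnj (exp (of_real pi * \<i> * w * of_real (t ^ 2)))"

text \<open>For \<open>Im w > 0\<close> the series over the integers converges absolutely.\<close>

definition periodized_gauss :: "nat \<Rightarrow> complex \<Rightarrow> int \<Rightarrow> complex" where
  "periodized_gauss N w n = (\<Sum>\<^sub>\<infinity>k::int. gauss w (of_int n - of_int k * of_nat N))"

definition induces_gabor_frame ::
    "nat \<Rightarrow> (int \<Rightarrow> complex) \<Rightarrow> nat \<Rightarrow> (nat \<Rightarrow> int) \<Rightarrow> (nat \<Rightarrow> int) \<Rightarrow> bool" where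
  "induces_gabor_frame N g K k l \<longleftrightarrow>
     (\<exists>A B. A > 0 \<and> B > 0 \<and>
       (\<forall>f. A * (vec_norm N f)\<^sup>2 \<le> (\<Sum>j=1..K. (cmod (gabor_transform N g f (k j) (l j)))\<^sup>2) \<and>
            (\<Sum>j=1..K. (cmod (gabor_transform N g f (k j) (l j)))\<^sup>2) \<le> B * (vec_norm N f)\<^sup>2))"

text \<open>
  The integer \<open>z\<^sub>2\<close> does not occur in the expression, and \<open>z\<^sub>1\<close> occurs in the sums over both \<open>k\<close> and \<open>l\<close>.
\<close>

definition divisibility_condition ::
    "nat \<Rightarrow> complex \<Rightarrow> (nat \<Rightarrow> int) \<Rightarrow> (nat \<Rightarrow> int) \<Rightarrow> bool" where
  "divisibility_condition N \<Omega> k l \<longleftrightarrow>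
     (\<forall>(z\<^sub>1::int) (z\<^sub>2::int) (z\<^sub>3::int) (z\<^sub>4::int). \<exists>q::int.
        (Re \<Omega> * of_int z\<^sub>3 + of_int z\<^sub>4) * (\<Sum>j=1..N. (of_int (k j) - real N / 2 + of_int z\<^sub>1))
        - (Re \<Omega> * (\<Sum>j=1..N. (of_int (k j) - real N / 2 + of_int z\<^sub>1))
            + (\<Sum>j=1..N. (of_int (l j) - real N / 2 + of_int z\<^sub>1))) * of_int z\<^sub>3
        = of_int q * real N)"

definition nat_multiples :: "nat \<Rightarrow> int set" where
  "nat_multiples N = range (\<lambda>n::nat. int (N * n))"

end

theory Submission
  imports Defs "HOL-Complex_Analysis.Complex_Analysis"
begin

text \<open>
  Up to a nonvanishing factor, the Gabor transform of \<open>f\<close> at \<open>(k, l)\<close> is the value at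
  \<open>(k \<Omega> + l) / N\<close> of a theta function of degree \<open>N\<close> for the lattice \<open>\<int> + \<int>\<Omega>\<close>, which determines
  \<open>f\<close>. A nonzero theta function of degree \<open>N\<close> has at most \<open>N\<close> zeros modulo the lattice, and if it
  vanishes at \<open>N\<close> distinct points then the class of their sum is prescribed; conversely, if \<open>N\<close>
  points have the prescribed sum, then vanishing at \<open>N - 1\<close> of them forces vanishing at the last one.
  The zeros are counted without contour integrals: a function \<open>lattice_theta\<close> with simple zeros exactly
  on the lattice is divided out, one zero at a time, until Liouville's theorem applies in degree \<open>0\<close>.
\<close>

text \<open>The Gabor points become w_j = (k_j \<Omega> + l_j) / N. The multiplier under \<Omega> is
  \<open>ee (- (of_nat N * \<Omega> / 2))\<close> for every vector, and each divided zero changes it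
  by the factor \<open>- ee (- w_j)\<close>. After N divisions a function of degree 0 remains, and a
  nonzero one exists only if its multiplier is an integral power of \<open>ee \<Omega>\<close>; so
  N/2 - N \<Omega>/2 minus the sum of the w_j must lie in the lattice. Since 1 and \<Omega> are
  independent over the reals, this says that the sum of the k_j and the sum of the l_j both lie in N
  (N/2 + \<int>). For odd N no integer has this form, for even N it is divisibility by N: this is
  where the parity condition comes from. For the converse a nonzero vector is needed that is
  orthogonal to all N atoms, but there is no formula for it. Counting unknowns yields one for N - 1
  of the equations, and dividing out the corresponding zeros leaves a theta function of degree 1,
  whose multiplier alone decides where it vanishes.\<close>

definition ee :: "complex \<Rightarrow> complex" where
  "ee w = exp (2 * of_real pi * \<i> * w)"

lemma ee_add: "ee (a + b) = ee a * ee b"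
  by (simp add: ee_def distrib_left exp_add)

lemma ee_diff: "ee (a - b) = ee a / ee b"
  by (simp add: ee_def right_diff_distrib exp_diff)

lemma ee_minus: "ee (- a) = inverse (ee a)"
  by (simp add: ee_def exp_minus)

lemma ee_0 [simp]: "ee 0 = 1"
  by (simp add: ee_def)

lemma ee_nonzero [simp]: "ee w \<noteq> 0"
  by (simp add: ee_def)

lemma ee_of_int [simp]: "ee (of_int n) = 1"
  using exp_integer_2pi[of "of_int n"] by (simp add: ee_def mult_ac)

lemma ee_1 [simp]: "ee 1 = 1"
  using ee_of_int[of 1] by simp

lemma ee_half [simp]: "ee (1/2) = -1"
  by (simp add: ee_def exp_pi_i')

lemma norm_ee: "norm (ee w) = exp (- (2 * pi * Im w))"
  by (simp add: ee_def)

lemma ee_of_nat_mult: "ee (of_nat n * w) = ee w ^ n"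
  by (simp add: ee_def exp_of_nat_mult[symmetric] mult_ac)

lemma ee_eq_1_iff: "ee w = 1 \<longleftrightarrow> w \<in> \<int>"
proof
  assume "ee w = 1"
  then obtain n :: int where "Im w = 0" "Re w = of_int n"
    by (auto simp: ee_def exp_eq_1)
  then have "w = of_int n" by (simp add: complex_eq_iff)
  then show "w \<in> \<int>" by simp
qed (auto elim: Ints_cases)

lemma holomorphic_on_ee [holomorphic_intros]:
  "f holomorphic_on A \<Longrightarrow> (\<lambda>w. ee (f w)) holomorphic_on A"
  unfolding ee_def by (intro holomorphic_intros)

lemma has_field_derivative_ee:
  "(ee has_field_derivative 2 * of_real pi * \<i> * ee w) (at w)"
  unfolding ee_def by (auto intro!: derivative_eq_intros)

section \<open>Entire functions\<close>

text \<open>Ratio test, shared by Euler's series and the half theta series below.\<close>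

lemma fps_conv_radius_inftyI:
  fixes a :: "nat \<Rightarrow> complex"
  assumes "\<And>n. a n \<noteq> 0" "(\<lambda>n. norm (a (Suc n) / a n)) \<longlonglongrightarrow> 0"
  shows "fps_conv_radius (Abs_fps a) = \<infinity>"
proof -
  have "filterlim (\<lambda>n. norm (a n) / norm (a (Suc n))) at_top sequentially"
    using filterlim_inverse_at_top[OF assms(2)] assms(1) by (simp add: norm_divide field_simps)
  then have "(\<lambda>n. ereal (norm (a n) / norm (a (Suc n)))) \<longlonglongrightarrow> \<infinity>"
    by (simp add: tendsto_PInfty_eq_at_top)
  then show ?thesis
    unfolding fps_conv_radius_def using assms(1)
    by (simp add: conv_radius_ratio_limit_ereal)
qed

lemma entire_imp_isCont: "f holomorphic_on UNIV \<Longrightarrow> isCont f z" for f :: "complex \<Rightarrow> complex"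
  by (metis UNIV_I field_differentiable_imp_continuous_at holomorphic_on_def)

lemma entire_imp_field_differentiable:
  "f holomorphic_on UNIV \<Longrightarrow> f field_differentiable at z" for f :: "complex \<Rightarrow> complex"
  by (simp add: holomorphic_on_def)

lemma entire_compose:
  "f holomorphic_on UNIV \<Longrightarrow> g holomorphic_on A \<Longrightarrow> (\<lambda>w. f (g w)) holomorphic_on A"
  using holomorphic_on_compose[of g A f] holomorphic_on_subset[of f UNIV "g ` A"] by (simp add: o_def)

lemma isCont_eventually_nonzero:
  fixes f :: "complex \<Rightarrow> complex"
  assumes "isCont f z" "f z \<noteq> 0"
  shows "eventually (\<lambda>w. f w \<noteq> 0) (nhds z)"
  using tendsto_imp_eventually_ne[OF isCont_tendsto_compose[OF assms(1) filterlim_ident] assms(2)] .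

text \<open>Near a zero z of \<open>g\<close> the quotient f / g equals the quotient of the two
  difference quotients at z. Both are entire, and the lower one does not vanish at z because the
  zero is simple. The value forced at z is l'Hopital's.\<close>

lemma entire_divide_simple_zeros:
  assumes f: "f holomorphic_on UNIV" and g: "g holomorphic_on UNIV"
    and simple: "\<And>z. g z = 0 \<Longrightarrow> deriv g z \<noteq> 0" and zero: "\<And>z. g z = 0 \<Longrightarrow> f z = 0"
  obtains h where "h holomorphic_on UNIV" "\<And>z. f z = g z * h z"
proof -
  define h where "h z = (if g z = 0 then deriv f z / deriv g z else f z / g z)" for z
  have "h field_differentiable at z" for z
  proof (cases "g z = 0")
    case True
    define f1 where "f1 = (\<lambda>w. if w = z then deriv f z else (f w - f z) / (w - z))"
    define g1 where "g1 = (\<lambda>w. if w = z then deriv g z else (g w - g z) / (w - z))"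
    have hol: "f1 holomorphic_on UNIV" "g1 holomorphic_on UNIV"
      unfolding f1_def g1_def using f g by (auto intro!: pole_lemma_open)
    have "g1 z \<noteq> 0" using simple[OF True] by (simp add: g1_def)
    then have ev: "eventually (\<lambda>w. g1 w \<noteq> 0) (nhds z)"
      using hol(2) by (intro isCont_eventually_nonzero entire_imp_isCont)
    have "(\<lambda>w. f1 w / g1 w) field_differentiable at z"
      using hol \<open>g1 z \<noteq> 0\<close> by (intro field_differentiable_divide entire_imp_field_differentiable)
    moreover have "eventually (\<lambda>w. f1 w / g1 w = h w) (nhds z)"
      using ev by eventually_elim (use True zero[OF True] in \<open>auto simp: f1_def g1_def h_def\<close>)
    ultimately show ?thesis
      unfolding field_differentiable_def by (auto simp: DERIV_cong_ev[OF refl _ refl])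
  next
    case False
    have ev: "eventually (\<lambda>w. g w \<noteq> 0) (nhds z)"
      using g False by (intro isCont_eventually_nonzero entire_imp_isCont)
    have "(\<lambda>w. f w / g w) field_differentiable at z"
      using f g False by (intro field_differentiable_divide entire_imp_field_differentiable)
    moreover have "eventually (\<lambda>w. f w / g w = h w) (nhds z)"
      using ev by eventually_elim (auto simp: h_def)
    ultimately show ?thesis
      unfolding field_differentiable_def by (auto simp: DERIV_cong_ev[OF refl _ refl])
  qed
  then have "h holomorphic_on UNIV"
    by (simp add: holomorphic_on_def)
  moreover have "f z = g z * h z" for z
    using zero by (auto simp: h_def)
  ultimately show ?thesis using that by blast
qed

section \<open>Theta functions of the lattice \<open>\<int> + \<int>\<tau>\<close>\<close>

locale upper_half_point =
  fixes \<tau> :: complex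
  assumes Im_pos: "Im \<tau> > 0"
begin

abbreviation q :: complex where "q \<equiv> ee \<tau>"

lemma norm_q: "norm q < 1"
  using Im_pos by (simp add: norm_ee)

lemma q_power_ne_1: "n > 0 \<Longrightarrow> q ^ n \<noteq> 1"
  using norm_q power_less_one_iff[of "norm q" n] by (auto simp: norm_power[symmetric])

text \<open>\<open>euler\<close> is Euler's series for the product of all \<open>1 - q\<^sup>n u\<close>, \<open>n \<ge> 0\<close>.\<close>

definition euler_coeff :: "nat \<Rightarrow> complex" where
  "euler_coeff n = (\<Prod>k<n. - (q ^ k) / (1 - q ^ Suc k))"

definition euler :: "complex \<Rightarrow> complex" where
  "euler = eval_fps (Abs_fps euler_coeff)"

lemma euler_conv_radius: "fps_conv_radius (Abs_fps euler_coeff) = \<infinity>"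
proof (rule fps_conv_radius_inftyI)
  have nz: "1 - q ^ Suc k \<noteq> 0" for k using q_power_ne_1[of "Suc k"] by simp
  show *: "euler_coeff n \<noteq> 0" for n
    using nz by (auto simp: euler_coeff_def)
  have "(\<lambda>n. q ^ n) \<longlonglongrightarrow> 0" using norm_q by (rule LIMSEQ_power_zero)
  then have "(\<lambda>n. norm (- (q ^ n) / (1 - q ^ Suc n))) \<longlonglongrightarrow> norm (- 0 / (1 - q * 0))"
    unfolding power_Suc by (intro tendsto_intros \<open>(\<lambda>n. q ^ n) \<longlonglongrightarrow> 0\<close>) simp_all
  moreover have "euler_coeff (Suc n) / euler_coeff n = - (q ^ n) / (1 - q ^ Suc n)" for n
    using *[of n] by (simp add: euler_coeff_def)
  ultimately show "(\<lambda>n. norm (euler_coeff (Suc n) / euler_coeff n)) \<longlonglongrightarrow> 0" by simp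
qed

lemma euler_sums: "(\<lambda>n. euler_coeff n * u ^ n) sums euler u"
  using sums_eval_fps[of u "Abs_fps euler_coeff"] euler_conv_radius by (simp add: euler_def)

lemma euler_holomorphic: "euler holomorphic_on A"
  unfolding euler_def by (intro holomorphic_on_eval_fps) (simp add: euler_conv_radius)

lemma euler_holomorphic' [holomorphic_intros]:
  "f holomorphic_on A \<Longrightarrow> (\<lambda>z. euler (f z)) holomorphic_on A"
  using holomorphic_on_compose[OF _ euler_holomorphic] by (simp add: o_def)

lemma isCont_euler: "isCont euler z"
  using euler_holomorphic by (rule entire_imp_isCont)

lemma euler_0: "euler 0 = 1"
  by (simp add: euler_def eval_fps_at_0 euler_coeff_def)

text \<open>The coefficients satisfy a_(n+1) (1 - q^(n+1)) = - q^n a_n, so the difference of the two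
  series is, after its vanishing constant term, - u times the series at
  \<open>q * u\<close>.\<close>

lemma euler_step: "euler u = (1 - u) * euler (q * u)"
proof -
  have "(\<lambda>n. euler_coeff n * u ^ n - euler_coeff n * (q * u) ^ n) sums (euler u - euler (q * u))"
    by (intro sums_diff euler_sums)
  then have "(\<lambda>n. euler_coeff (Suc n) * u ^ Suc n - euler_coeff (Suc n) * (q * u) ^ Suc n) sums
      (euler u - euler (q * u))"
    by (subst sums_Suc_iff) simp
  moreover have "euler_coeff (Suc n) * u ^ Suc n - euler_coeff (Suc n) * (q * u) ^ Suc n =
      - u * (euler_coeff n * (q * u) ^ n)" for n
  proof -
    have "1 - q ^ Suc n \<noteq> 0" using q_power_ne_1[of "Suc n"] by simp
    then have "euler_coeff (Suc n) * (1 - q ^ Suc n) = - (q ^ n) * euler_coeff n"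
      by (simp add: euler_coeff_def)
    then have "euler_coeff (Suc n) * (1 - q ^ Suc n) * u ^ Suc n = - (q ^ n) * euler_coeff n * u ^ Suc n"
      by simp
    then show ?thesis by (simp add: algebra_simps power_mult_distrib)
  qed
  moreover have "(\<lambda>n. - u * (euler_coeff n * (q * u) ^ n)) sums (- u * euler (q * u))"
    by (intro sums_mult euler_sums)
  ultimately have "euler u - euler (q * u) = - u * euler (q * u)"
    by (simp add: sums_unique2)
  then show ?thesis by (simp add: algebra_simps)
qed

text \<open>If no factor 1 - q^n u vanishes, \<open>euler_step\<close> carries the zero from u to
  all q^n u. These tend to 0, where \<open>euler\<close> is 1, against continuity.\<close>

lemma euler_zeroD:
  assumes "euler u = 0"
  obtains n where "q ^ n * u = 1"
proof (rule ccontr)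
  assume "\<not> thesis"
  then have no: "q ^ n * u \<noteq> 1" for n using that by blast
  have *: "euler (q ^ n * u) = 0" for n
  proof (induction n)
    case (Suc n)
    have "(1 - q ^ n * u) * euler (q ^ Suc n * u) = 0"
      using Suc euler_step[of "q ^ n * u"] by (simp add: mult_ac)
    then show ?case using no[of n] by auto
  qed (use assms in simp)
  have "(\<lambda>n. q ^ n * u) \<longlonglongrightarrow> 0 * u"
    using norm_q by (intro tendsto_intros LIMSEQ_power_zero)
  then have "(\<lambda>n. q ^ n * u) \<longlonglongrightarrow> 0" by simp
  from isCont_tendsto_compose[OF isCont_euler this]
  have "(\<lambda>n. euler (q ^ n * u)) \<longlonglongrightarrow> euler 0" .
  then show False unfolding * euler_0 by (simp add: LIMSEQ_const_iff)
qed

text \<open>By the Jacobi triple product this is a multiple of a theta series; only its zeros matter here.\<close>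

definition lattice_theta :: "complex \<Rightarrow> complex" where
  "lattice_theta w = euler (ee w) * euler (q * ee (- w))"

lemma lattice_theta_holomorphic [holomorphic_intros]:
  "f holomorphic_on A \<Longrightarrow> (\<lambda>w. lattice_theta (f w)) holomorphic_on A"
  unfolding lattice_theta_def by (intro holomorphic_intros)

lemma lattice_theta_plus_1: "lattice_theta (w + 1) = lattice_theta w"
  by (simp add: lattice_theta_def ee_add ee_diff ee_minus)

text \<open>With u = \<open>ee w\<close>, the shift replaces u by q u: the first product loses the
  factor 1 - u, the second gains 1 - 1/u, and the ratio of the two is - 1/u.\<close>

lemma lattice_theta_plus_tau: "lattice_theta (w + \<tau>) = - ee (- w) * lattice_theta w"
proof -
  have "q * ee (- (w + \<tau>)) = ee (- w)" by (simp only: ee_add ee_minus) simp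
  moreover have "ee (w + \<tau>) = q * ee w" by (simp add: ee_add mult_ac)
  ultimately have "lattice_theta (w + \<tau>) = euler (q * ee w) * ((1 - ee (- w)) * euler (q * ee (- w)))"
    unfolding lattice_theta_def using euler_step[of "ee (- w)"] by simp
  also have "\<dots> = - ee (- w) * ((1 - ee w) * euler (q * ee w)) * euler (q * ee (- w))"
    by (simp add: ee_minus field_simps)
  finally show ?thesis using euler_step[of "ee w"] by (simp add: lattice_theta_def)
qed

text \<open>Invariance is required as an equivalence, so that the same two hypotheses serve the
  downward steps to negative \<open>m\<close> and \<open>n\<close>. It is applied to vanishing, to
  having a simple zero, and to a bound on the modulus.\<close>

lemma lattice_induct:
  assumes one: "\<And>w. R (w + 1) \<longleftrightarrow> R w" and tau: "\<And>w. R (w + \<tau>) \<longleftrightarrow> R w"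
  shows "R (w + of_int m + of_int n * \<tau>) \<longleftrightarrow> R w"
proof -
  have 1: "R (w + of_int m) \<longleftrightarrow> R w" for w
  proof (induction m rule: int_induct[where k = 0])
    case (step1 i) then show ?case using one[of "w + of_int i"] by (simp add: add_ac)
  next
    case (step2 i) then show ?case using one[of "w + of_int i - 1"] by (simp add: algebra_simps)
  qed simp
  have 2: "R (w + of_int n * \<tau>) \<longleftrightarrow> R w" for w
  proof (induction n rule: int_induct[where k = 0])
    case (step1 i) then show ?case using tau[of "w + of_int i * \<tau>"] by (simp add: algebra_simps)
  next
    case (step2 i) then show ?case using tau[of "w + of_int i * \<tau> - \<tau>"] by (simp add: algebra_simps)
  qed simp
  show ?thesis using 1 2 by simp
qed

definition lattice :: "complex set" where
  "lattice = {of_int m + of_int n * \<tau> | m n. True}"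

text \<open>Only the factor \<open>1 - ee w\<close> vanishes at 0. The cofactor is the square of
  \<open>euler q\<close> there, which is nonzero because no positive power of \<open>q\<close> is
  1.\<close>

lemma lattice_theta_deriv_0: "\<exists>d. d \<noteq> 0 \<and> (lattice_theta has_field_derivative d) (at 0)"
proof -
  define R where "R w = euler (q * ee w) * euler (q * ee (- w))" for w
  have factor: "lattice_theta = (\<lambda>w. (1 - ee w) * R w)"
  proof
    show "lattice_theta w = (1 - ee w) * R w" for w
      using euler_step[of "ee w"] by (simp add: lattice_theta_def R_def)
  qed
  have "R holomorphic_on UNIV" unfolding R_def by (intro holomorphic_intros)
  then obtain d where d: "(R has_field_derivative d) (at 0)"
    by (metis UNIV_I field_differentiable_def holomorphic_on_def)
  have "((\<lambda>w. (1 - ee w) * R w) has_field_derivative - (2 * of_real pi * \<i>) * R 0) (at 0)"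
    by (rule derivative_eq_intros d has_field_derivative_ee refl)+ simp
  moreover have "euler q \<noteq> 0"
  proof
    assume "euler q = 0"
    then obtain n where "q ^ n * q = 1" using euler_zeroD by blast
    then show False using q_power_ne_1[of "Suc n"] by (simp add: mult_ac)
  qed
  then have "R 0 \<noteq> 0" by (simp add: R_def)
  ultimately show ?thesis unfolding factor by (intro exI[of _ "- (2 * of_real pi * \<i>) * R 0"]) simp
qed

text \<open>The first factor can vanish only where \<open>ee w\<close> is q^(-n), the second only
  where it is q^(n+1), n \<ge> 0; together these are all integral powers of \<open>q\<close>.
  Conversely, quasi-periodicity spreads the zero at 0 over the lattice.\<close>

lemma lattice_theta_zero_iff: "lattice_theta w = 0 \<longleftrightarrow> w \<in> lattice"
proof
  assume "lattice_theta w = 0"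
  then have "euler (ee w) = 0 \<or> euler (q * ee (- w)) = 0" by (simp add: lattice_theta_def)
  then have "\<exists>n::int. ee (w + of_int n * \<tau>) = 1"
  proof
    assume "euler (ee w) = 0"
    then obtain n where "q ^ n * ee w = 1" using euler_zeroD by blast
    then show ?thesis
      by (intro exI[of _ "int n"]) (simp add: ee_add ee_of_nat_mult, simp add: mult_ac)
  next
    assume "euler (q * ee (- w)) = 0"
    then obtain n where "q ^ n * (q * ee (- w)) = 1" using euler_zeroD by blast
    then have "ee (of_nat (Suc n) * \<tau> - w) = 1"
      unfolding ee_of_nat_mult ee_diff by (simp add: ee_minus field_simps)
    then have "inverse (ee (of_nat (Suc n) * \<tau> - w)) = 1" by simp
    then show ?thesis
      by (intro exI[of _ "- int (Suc n)"]) (simp add: ee_minus[symmetric] algebra_simps)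
  qed
  then obtain n m :: int where "w + of_int n * \<tau> = of_int m"
    by (auto simp: ee_eq_1_iff elim: Ints_cases)
  then have "w = of_int m + of_int (- n) * \<tau>" by (simp add: algebra_simps)
  then show "w \<in> lattice" unfolding lattice_def by blast
next
  have "lattice_theta 0 = 0" using euler_step[of 1] by (simp add: lattice_theta_def)
  moreover have "lattice_theta (0 + of_int m + of_int n * \<tau>) = 0 \<longleftrightarrow> lattice_theta 0 = 0" for m n
    by (rule lattice_induct) (simp_all add: lattice_theta_plus_1 lattice_theta_plus_tau)
  moreover assume "w \<in> lattice"
  ultimately show "lattice_theta w = 0" by (auto simp: lattice_def)
qed

lemma lattice_theta_simple_zeros:
  assumes "lattice_theta w = 0"
  shows "deriv lattice_theta w \<noteq> 0"
proof -
  have D: "(lattice_theta has_field_derivative deriv lattice_theta z) (at z)" for z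
    using lattice_theta_holomorphic[of "\<lambda>w. w" UNIV]
    by (intro holomorphic_derivI[of _ UNIV]) (auto intro: holomorphic_intros)
  have 1: "deriv lattice_theta (z + 1) = deriv lattice_theta z" for z
  proof (rule DERIV_unique)
    show "(lattice_theta has_field_derivative deriv lattice_theta (z + 1)) (at (z + 1))" by (rule D)
    show "(lattice_theta has_field_derivative deriv lattice_theta z) (at (z + 1))"
      using D[of z] by (simp add: DERIV_shift lattice_theta_plus_1)
  qed
  have 2: "deriv lattice_theta (z + \<tau>) = - ee (- z) * deriv lattice_theta z" if "lattice_theta z = 0" for z
  proof (rule DERIV_unique)
    show "(lattice_theta has_field_derivative deriv lattice_theta (z + \<tau>)) (at (z + \<tau>))" by (rule D)
    have "(\<lambda>w. - ee (- w)) holomorphic_on UNIV" by (intro holomorphic_intros)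
    then obtain d where d: "((\<lambda>w. - ee (- w)) has_field_derivative d) (at z)"
      by (metis UNIV_I field_differentiable_def holomorphic_on_def)
    have "((\<lambda>w. - ee (- w) * lattice_theta w) has_field_derivative - ee (- z) * deriv lattice_theta z) (at z)"
      using DERIV_mult[OF d D[of z]] that by (simp add: mult_ac)
    then show "(lattice_theta has_field_derivative - ee (- z) * deriv lattice_theta z) (at (z + \<tau>))"
      by (simp only: DERIV_shift lattice_theta_plus_tau)
  qed
  have d0: "deriv lattice_theta 0 \<noteq> 0" using lattice_theta_deriv_0 DERIV_imp_deriv by blast
  have P0: "lattice_theta 0 = 0" using euler_step[of 1] by (simp add: lattice_theta_def)
  obtain m n where w: "w = 0 + of_int m + of_int n * \<tau>"
    using assms lattice_theta_zero_iff[of w] by (auto simp: lattice_def)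
  \<comment> \<open>Vanishing is part of the transported predicate: the derivative of the
    \<tau>-equation contains a term with \<open>lattice_theta\<close> itself, which disappears only
    at zeros.\<close>
  have "(lattice_theta w = 0 \<and> deriv lattice_theta w \<noteq> 0) \<longleftrightarrow> (lattice_theta 0 = 0 \<and> deriv lattice_theta 0 \<noteq> 0)"
    by (subst (1 2) w, rule lattice_induct[where R = "\<lambda>w. lattice_theta w = 0 \<and> deriv lattice_theta w \<noteq> 0"])
      (auto simp: lattice_theta_plus_1 lattice_theta_plus_tau 1 2)
  with assms P0 have *: "deriv lattice_theta 0 \<noteq> 0 \<longleftrightarrow> deriv lattice_theta w \<noteq> 0" by simp
  with d0 show ?thesis by simp
qed

section \<open>Theta functions of degree M: division by zeros and the degrees 0 and 1\<close>

text \<open>The sections of a line bundle of degree M on the complex torus; c distinguishes the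
  bundles of equal degree. \<open>lattice_theta\<close> belongs to
  \<open>theta_space 1 (-1)\<close>.\<close>

definition theta_space :: "nat \<Rightarrow> complex \<Rightarrow> (complex \<Rightarrow> complex) set" where
  "theta_space M c = {F. F holomorphic_on UNIV \<and> (\<forall>w. F (w + 1) = F w) \<and>
     (\<forall>w. F (w + \<tau>) = c * ee (- (of_nat M * w)) * F w)}"

lemma theta_space_zero_lattice:
  assumes "F \<in> theta_space M c" "c \<noteq> 0" "F a = 0" "w - a \<in> lattice"
  shows "F w = 0"
proof -
  obtain m n where w: "w = a + of_int m + of_int n * \<tau>"
    using assms(4) by (auto simp: lattice_def algebra_simps)
  have "F w = 0 \<longleftrightarrow> F a = 0"
    unfolding w by (rule lattice_induct[where R = "\<lambda>w. F w = 0"])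
      (use assms in \<open>auto simp: theta_space_def\<close>)
  then show ?thesis using assms by simp
qed

text \<open>The divisor \<open>lattice_theta (w - a)\<close> has multiplier
  \<open>- ee (a - w)\<close>. Its quotient into the multiplier of \<open>F\<close> lowers the
  degree by one and leaves the constant \<open>- c * ee (- a)\<close>.\<close>

lemma theta_space_divide:
  assumes F: "F \<in> theta_space (Suc M) c" and c: "c \<noteq> 0" and zero: "F a = 0"
  obtains G where "G \<in> theta_space M (- c * ee (- a))" "\<And>w. F w = lattice_theta (w - a) * G w"
proof -
  have hF: "F holomorphic_on UNIV" and F1: "F (w + 1) = F w"
    and Ft: "F (w + \<tau>) = c * ee (- (of_nat (Suc M) * w)) * F w" for w
    using F by (auto simp: theta_space_def)
  define g where "g = (\<lambda>w. lattice_theta (w - a))"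
  have hg: "g holomorphic_on UNIV" unfolding g_def by (intro holomorphic_intros)
  have "deriv g w = deriv lattice_theta (w - a)" for w
  proof -
    have hP: "lattice_theta holomorphic_on UNIV" using lattice_theta_holomorphic[of "\<lambda>w. w" UNIV] by simp
    have "(lattice_theta has_field_derivative deriv lattice_theta (w - a)) (at (w - a))"
      using hP by (rule holomorphic_derivI) auto
    then have "(g has_field_derivative deriv lattice_theta (w - a)) (at w)"
      unfolding g_def using DERIV_shift[of lattice_theta "deriv lattice_theta (w - a)" w "- a"] by simp
    then show ?thesis by (rule DERIV_imp_deriv)
  qed
  then have simple: "deriv g w \<noteq> 0" if "g w = 0" for w
    using that lattice_theta_simple_zeros by (simp add: g_def)
  have "F w = 0" if "g w = 0" for w
    using that theta_space_zero_lattice[OF F c zero] by (simp add: g_def lattice_theta_zero_iff)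
  then obtain G where G: "G holomorphic_on UNIV" "\<And>w. F w = g w * G w"
    using entire_divide_simple_zeros[OF hF hg] simple by metis
  have g1: "g (w + 1) = g w" for w
    using lattice_theta_plus_1[of "w - a"] by (simp add: g_def algebra_simps)
  have gt: "g (w + \<tau>) = - ee (a - w) * g w" for w
    using lattice_theta_plus_tau[of "w - a"] by (simp add: g_def algebra_simps)
  text \<open>The functional equations transfer to the quotient off the zeros of \<open>g\<close>, hence everywhere.\<close>
  have cancel: "H1 z = H2 z" if "\<And>w. g w * H1 w = g w * H2 w"
    "H1 holomorphic_on UNIV" "H2 holomorphic_on UNIV" for H1 H2 z
  proof (cases "g z = 0")
    case False
    then show ?thesis using that(1)[of z] by simp
  next
    case True
    \<comment> \<open>Two equal products are differentiated at a zero of \<open>g\<close>: the terms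
      containing \<open>g z\<close> drop out, and \<open>deriv g z\<close> can be cancelled.\<close>
    have "((\<lambda>w. H1 w * g w) has_field_derivative deriv H1 z * g z + deriv g z * H1 z) (at z)"
      "((\<lambda>w. H2 w * g w) has_field_derivative deriv H2 z * g z + deriv g z * H2 z) (at z)"
      using that(2,3) hg by (auto intro!: DERIV_mult holomorphic_derivI)
    moreover have "(\<lambda>w. H1 w * g w) = (\<lambda>w. H2 w * g w)"
      using that(1) by (metis mult.commute)
    ultimately have "deriv H1 z * g z + deriv g z * H1 z = deriv H2 z * g z + deriv g z * H2 z"
      using DERIV_unique by metis
    then show ?thesis using True simple[OF True] by simp
  qed
  have sh: "(\<lambda>w. G (w + b)) holomorphic_on UNIV" for b
    using G(1) by (rule entire_compose) (intro holomorphic_intros)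
  have "G (w + 1) = G w" for w
  proof (rule cancel[where ?H1.0 = "\<lambda>w. G (w + 1)" and ?H2.0 = G])
    show "g w * G (w + 1) = g w * G w" for w
      using G(2)[of w] G(2)[of "w + 1"] by (auto simp: F1 g1)
  qed (use sh G in auto)
  moreover have "G (w + \<tau>) = (- c * ee (- a)) * ee (- (of_nat M * w)) * G w" for w
  proof (rule cancel[where ?H1.0 = "\<lambda>w. G (w + \<tau>)"
        and ?H2.0 = "\<lambda>w. (- c * ee (- a)) * ee (- (of_nat M * w)) * G w"])
    show "g w * G (w + \<tau>) = g w * ((- c * ee (- a)) * ee (- (of_nat M * w)) * G w)" for w
    proof -
      have "- ee (a - w) * (g w * G (w + \<tau>)) = c * ee (- (of_nat (Suc M) * w)) * (g w * G w)"
        using Ft[of w] G(2)[of w] G(2)[of "w + \<tau>"] gt[of w] by (metis mult.assoc)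
      also have "ee (- (of_nat (Suc M) * w)) = ee (a - w) * (ee (- a) * ee (- (of_nat M * w)))"
        unfolding ee_add[symmetric] by (simp add: algebra_simps)
      finally have "- ee (a - w) * (g w * G (w + \<tau>)) =
        - ee (a - w) * (g w * ((- c * ee (- a)) * ee (- (of_nat M * w)) * G w))"
        by (simp add: mult_ac)
      then show ?thesis by (subst (asm) mult_left_cancel) simp_all
    qed
  qed (use sh G in \<open>auto intro!: holomorphic_intros\<close>)
  ultimately have "G \<in> theta_space M (- c * ee (- a))"
    using G(1) by (simp add: theta_space_def)
  then show ?thesis using that G(2) by (simp add: g_def)
qed

text \<open>Inequivalence modulo the lattice keeps the factors already removed nonzero at the next
  point, so the quotient still vanishes there. Every division contributes
  \<open>- ee (- a j)\<close>; the signs are collected as \<open>ee (1/2)\<close>.\<close>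

lemma theta_space_divide_prod:
  fixes a :: "'i \<Rightarrow> complex"
  assumes "finite J" "F \<in> theta_space (M + card J) c" "c \<noteq> 0" "\<And>j. j \<in> J \<Longrightarrow> F (a j) = 0"
    and "\<And>i j. i \<in> J \<Longrightarrow> j \<in> J \<Longrightarrow> i \<noteq> j \<Longrightarrow> a i - a j \<notin> lattice"
  obtains G where "G \<in> theta_space M (c * ee (of_nat (card J) / 2 - (\<Sum>j\<in>J. a j)))"
    "\<And>w. F w = (\<Prod>j\<in>J. lattice_theta (w - a j)) * G w"
  using assms
proof (induction J arbitrary: thesis M rule: finite_induct)
  case empty
  then show ?case by simp
next
  case (insert i J)
  let ?c = "c * ee (of_nat (card J) / 2 - (\<Sum>j\<in>J. a j))"
  obtain G where G: "G \<in> theta_space (Suc M) ?c" "\<And>w. F w = (\<Prod>j\<in>J. lattice_theta (w - a j)) * G w"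
  proof (rule insert.IH)
    show "F \<in> theta_space (Suc M + card J) c" using insert by simp
    show "F (a j) = 0" if "j \<in> J" for j using that insert.prems by simp
    show "a i' - a j' \<notin> lattice" if "i' \<in> J" "j' \<in> J" "i' \<noteq> j'" for i' j'
      using that insert.prems by blast
  qed (use insert.prems in auto)
  have "F (a i) = 0" using insert.prems by simp
  moreover have "lattice_theta (a i - a j) \<noteq> 0" if "j \<in> J" for j
    using that insert.prems(5)[of i j] insert.hyps by (auto simp: lattice_theta_zero_iff)
  ultimately have "G (a i) = 0" using insert.hyps G(2)[of "a i"] by auto
  then obtain H where H: "H \<in> theta_space M (- ?c * ee (- a i))" "\<And>w. G w = lattice_theta (w - a i) * H w"
    using theta_space_divide[OF G(1)] insert.prems(3) by auto
  have eq: "- ?c * ee (- a i) = c * ee (of_nat (card (insert i J)) / 2 - (\<Sum>j\<in>insert i J. a j))"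
  proof -
    have "ee (of_nat (card (insert i J)) / 2 - (\<Sum>j\<in>insert i J. a j))
      = ee (1/2 + ((of_nat (card J) / 2 - (\<Sum>j\<in>J. a j)) + - a i))"
      using insert.hyps by (simp add: add_divide_distrib algebra_simps)
    then show ?thesis unfolding ee_add by simp
  qed
  show ?case
  proof (rule insert.prems(1))
    show "H \<in> theta_space M (c * ee (of_nat (card (insert i J)) / 2 - (\<Sum>j\<in>insert i J. a j)))"
      using H(1) unfolding eq .
    show "F w = (\<Prod>j\<in>insert i J. lattice_theta (w - a j)) * H w" for w
      using insert.hyps by (simp add: G(2) H(2) mult_ac)
  qed
qed

text \<open>Scaling by \<open>exp (- t Im w)\<close> makes \<open>|F|\<close> doubly periodic, so Liouville's theorem applies.\<close>

lemma theta_space_0: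
  assumes F: "F \<in> theta_space 0 c" and c: "c \<noteq> 0"
  shows "(\<forall>w. F w = 0) \<or> ((\<forall>w. F w \<noteq> 0) \<and> (\<exists>n::int. c = ee (of_int n * \<tau>)))"
proof -
  have hF: "F holomorphic_on UNIV" and F1: "F (w + 1) = F w" and Ft: "F (w + \<tau>) = c * F w" for w
    using F by (auto simp: theta_space_def)
  \<comment> \<open>Chosen so that \<open>ee (of_real t * \<tau>)\<close> has modulus 1 / |c|, which
    offsets the multiplier; being real, t does not disturb the modulus under w + 1.\<close>
  define t where "t = ln (norm c) / (2 * pi * Im \<tau>)"
  define H where "H w = F w * ee (of_real t * w)" for w
  have hH: "H holomorphic_on UNIV"
    unfolding H_def using hF by (intro holomorphic_intros)
  have "2 * pi * t * Im \<tau> = ln (norm c)"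
    using Im_pos by (simp add: t_def)
  then have "norm (ee (of_real t * \<tau>)) = inverse (norm c)"
    using c by (simp add: norm_ee exp_minus mult_ac)
  then have 1: "norm (H (w + \<tau>)) = norm (H w)" for w
    using c by (simp add: H_def Ft norm_mult distrib_left ee_add)
  have 2: "norm (H (w + 1)) = norm (H w)" for w
    by (simp add: H_def F1 norm_mult norm_ee)
  define K where "K = (\<lambda>(x,y). of_real x + of_real y * \<tau>) ` ({0..1} \<times> {0..1::real})"
  have "compact K" unfolding K_def
    by (intro compact_continuous_image compact_Times)
       (auto simp: case_prod_unfold intro!: continuous_intros)
  then have "bounded (H ` K)"
    by (intro compact_imp_bounded compact_continuous_image)
       (auto intro: holomorphic_on_imp_continuous_on holomorphic_on_subset[OF hH])
  then obtain B where B: "\<And>w. w \<in> K \<Longrightarrow> norm (H w) \<le> B" by (auto simp: bounded_iff)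
  have "norm (H w) \<le> B" for w
  proof -
    define y where "y = Im w / Im \<tau>"
    define x where "x = Re w - y * Re \<tau>"
    have w: "w = of_real x + of_real y * \<tau>"
      using Im_pos by (simp add: complex_eq_iff x_def y_def)
    define z where "z = of_real (frac x) + of_real (frac y) * \<tau>"
    have "z \<in> K" unfolding K_def z_def
      by (rule image_eqI[of _ _ "(frac x, frac y)"]) (auto simp: frac_ge_0 less_imp_le frac_lt_1)
    have wz: "w = z + of_int \<lfloor>x\<rfloor> + of_int \<lfloor>y\<rfloor> * \<tau>"
      by (simp add: w z_def frac_def algebra_simps)
    have "norm (H w) \<le> B \<longleftrightarrow> norm (H z) \<le> B"
      unfolding wz by (rule lattice_induct[where R = "\<lambda>w. norm (H w) \<le> B"]) (simp_all add: 1 2)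
    then show ?thesis using B \<open>z \<in> K\<close> by simp
  qed
  then have "bounded (range H)" by (auto simp: bounded_iff)
  then obtain a where a: "\<And>w. H w = a"
    using Liouville_theorem[OF hH] by (auto simp: constant_on_def)
  have Fa: "F w = a * ee (- (of_real t * w))" for w
    using a[of w] by (simp add: H_def ee_minus field_simps)
  show ?thesis
  proof (cases "a = 0")
    case False
    \<comment> \<open>Now \<open>F\<close> is a pure exponential: period 1 forces t to be an
      integer, and then the shift by \<tau> identifies c.\<close>
    have "a * ee (- of_real t) = a"
      using F1[of 0] Fa[of 0] Fa[of 1] by simp
    then have "- complex_of_real t \<in> \<int>" using False by (simp add: ee_eq_1_iff)
    then obtain n where n: "- complex_of_real t = of_int n" by (blast elim: Ints_cases)
    have "c = ee (- of_real t * \<tau>)"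
      using Ft[of 0] Fa[of 0] Fa[of \<tau>] False by simp
    then have "c = ee (of_int n * \<tau>)" unfolding n .
    then show ?thesis using Fa False by auto
  qed (use Fa in auto)
qed

text \<open>In degree 1 the multiplier determines the zero; this is the case normalised to have it
  at the origin. It suffices that D vanishes identically, because \<open>D 0\<close> is twice
  \<open>H 0\<close>.\<close>

lemma theta_space_1_zero_0:
  assumes H: "H \<in> theta_space 1 (-1)"
  shows "H 0 = 0"
proof -
  have hH: "H holomorphic_on UNIV" and H1: "H (w + 1) = H w"
    and Ht: "H (w + \<tau>) = - ee (- w) * H w" for w
    using H by (auto simp: theta_space_def)
  text \<open>The symmetrization of \<open>H\<close> is forced to vanish at \<open>1/2\<close>, which its multiplier only allows if it is \<open>0\<close>.\<close>
  define D where "D w = H w + ee w * H (- w)" for w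
  have "(\<lambda>w. H (- w)) holomorphic_on UNIV"
    using hH by (rule entire_compose) (intro holomorphic_intros)
  then have hD: "D holomorphic_on UNIV"
    unfolding D_def using hH by (intro holomorphic_intros)
  have m1: "H (- (w + 1)) = H (- w)" for w
    using H1[of "- (w + 1)"] by simp
  have mt: "ee (w + \<tau>) * H (- (w + \<tau>)) = - H (- w)" for w
    using Ht[of "- (w + \<tau>)"] by (simp add: add.commute)
  have "D \<in> theta_space 1 (-1)"
    unfolding theta_space_def
  proof (intro CollectI conjI allI)
    show "D (w + 1) = D w" for w by (simp only: D_def H1 m1 ee_add ee_1 mult_1_right)
    show "D (w + \<tau>) = - 1 * ee (- (of_nat 1 * w)) * D w" for w
      unfolding D_def mt Ht by (simp add: ee_minus field_simps)
  qed (rule hD)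
  \<comment> \<open>\<open>ee (1/2)\<close> is -1 and periodicity gives
    \<open>H (-1/2) = H (1/2)\<close>, so the two terms cancel.\<close>
  moreover have "D (1/2) = 0"
    using H1[of "-1/2"] by (simp add: D_def)
  ultimately obtain G where G: "G \<in> theta_space 0 (- (- 1) * ee (- (1/2)))"
      "\<And>w. D w = lattice_theta (w - 1/2) * G w"
    using theta_space_divide[of D 0 "-1" "1/2"] by auto
  have "ee (- (1/2)) = -1" unfolding ee_minus ee_half by simp
  then have G': "G \<in> theta_space 0 (- 1)" using G(1) by simp
  \<comment> \<open>The multiplier -1 is not an integral power of \<open>ee \<tau>\<close>: modulus
    1 would force the exponent 0, whose value is 1.\<close>
  have "(\<forall>w. G w = 0)"
  proof (rule ccontr)
    assume "\<not> ?thesis"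
    then obtain n :: int where n: "- 1 = ee (of_int n * \<tau>)"
      using theta_space_0[OF G'] by auto
    have "norm (ee (of_int n * \<tau>)) = 1" unfolding n[symmetric] by simp
    then have "n = 0" using Im_pos by (simp add: norm_ee)
    with n show False by simp
  qed
  then have "D 0 = 0" using G(2) by simp
  then show ?thesis by (simp add: D_def)
qed

text \<open>Translation by b removes \<open>ee b\<close> from the multiplier and the twist by
  \<open>ee (- (of_int n * w))\<close> removes \<open>ee (of_int n * \<tau>)\<close>; an integral n
  preserves the period 1.\<close>

lemma theta_space_1_zero:
  assumes G: "G \<in> theta_space 1 c" and c: "c = - ee (b + of_int n * \<tau>)"
  shows "G b = 0"
proof -
  have hG: "G holomorphic_on UNIV" and G1: "G (w + 1) = G w"
    and Gt: "G (w + \<tau>) = c * ee (- w) * G w" for w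
    using G by (auto simp: theta_space_def)
  define H where "H w = G (w + b) * ee (- (of_int n * w))" for w
  have "(\<lambda>w. G (w + b)) holomorphic_on UNIV"
    using hG by (rule entire_compose) (intro holomorphic_intros)
  then have hH: "H holomorphic_on UNIV"
    unfolding H_def by (intro holomorphic_intros)
  have "ee (- (of_int n * (w + 1))) = ee (- (of_int n * w))" for w
    by (simp add: ee_minus ee_diff distrib_left)
  then have "H (w + 1) = H w" for w
    unfolding H_def using G1[of "w + b"] by (metis add.assoc add.commute)
  moreover have "H (w + \<tau>) = - ee (- w) * H w" for w
  proof -
    have "H (w + \<tau>) = c * ee (- (w + b)) * G (w + b) * ee (- (of_int n * (w + \<tau>)))"
      using Gt[of "w + b"] by (simp add: H_def add_ac)
    also have "\<dots> = - ((ee (b + of_int n * \<tau>) * ee (- (w + b))) * ee (- (of_int n * (w + \<tau>)))) * G (w + b)"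
      by (simp add: c mult_ac)
    also have "(ee (b + of_int n * \<tau>) * ee (- (w + b))) * ee (- (of_int n * (w + \<tau>)))
       = ee (- w) * ee (- (of_int n * w))"
      unfolding ee_add[symmetric] by (simp add: algebra_simps)
    finally show ?thesis by (simp add: H_def)
  qed
  ultimately have "H \<in> theta_space 1 (-1)" using hH by (simp add: theta_space_def)
  from theta_space_1_zero_0[OF this] show ?thesis by (simp add: H_def)
qed

text \<open>The first part is Abel's theorem for theta functions.\<close>

lemma theta_space_zeros:
  fixes a :: "'i \<Rightarrow> complex"
  assumes "finite J" "F \<in> theta_space (card J) c" "c \<noteq> 0" "\<And>j. j \<in> J \<Longrightarrow> F (a j) = 0"
    and "\<And>i j. i \<in> J \<Longrightarrow> j \<in> J \<Longrightarrow> i \<noteq> j \<Longrightarrow> a i - a j \<notin> lattice" and "F w0 \<noteq> 0"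
  shows "\<exists>n::int. c * ee (of_nat (card J) / 2 - (\<Sum>j\<in>J. a j)) = ee (of_int n * \<tau>)"
    and "F w = 0 \<Longrightarrow> \<exists>j\<in>J. w - a j \<in> lattice"
proof -
  let ?c = "c * ee (of_nat (card J) / 2 - (\<Sum>j\<in>J. a j))"
  have "F \<in> theta_space (0 + card J) c" using assms(2) by simp
  then obtain G where G: "G \<in> theta_space 0 ?c" "\<And>w. F w = (\<Prod>j\<in>J. lattice_theta (w - a j)) * G w"
    using theta_space_divide_prod[where J = J and F = F and M = 0 and c = c and a = a] assms(1,3-5)
    by blast
  have "?c \<noteq> 0" using assms(3) by simp
  \<comment> \<open>The remaining factor has degree 0 and is not identically zero, so it has no
    zeros: every zero of \<open>F\<close> comes from the product.\<close>
  have "(\<forall>w. G w \<noteq> 0) \<and> (\<exists>n::int. ?c = ee (of_int n * \<tau>))"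
    using theta_space_0[OF G(1) \<open>?c \<noteq> 0\<close>] G(2)[of w0] assms(6) by auto
  then show "\<exists>n::int. ?c = ee (of_int n * \<tau>)" "F w = 0 \<Longrightarrow> \<exists>j\<in>J. w - a j \<in> lattice"
    using assms(1) by (auto simp: G(2) lattice_theta_zero_iff)
qed

end

section \<open>The Gabor transform as a theta function\<close>

lemma has_sum_int_split:
  fixes f :: "int \<Rightarrow> complex"
  assumes "((\<lambda>n. f (int n)) has_sum a) UNIV" "((\<lambda>n. f (- int (Suc n))) has_sum b) UNIV"
  shows "(f has_sum (a + b)) UNIV"
proof -
  have 1: "(f has_sum a) (range int)"
    using assms(1) by (subst has_sum_reindex) (auto simp: o_def inj_def)
  have 2: "(f has_sum b) (range (\<lambda>n. - int (Suc n)))"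
    using assms(2) by (subst has_sum_reindex) (auto simp: o_def inj_def)
  have "x \<in> range int \<union> range (\<lambda>n. - int (Suc n))" for x
    by (cases x rule: int_cases) auto
  then have "range int \<union> range (\<lambda>n. - int (Suc n)) = UNIV" by auto
  moreover have "range int \<inter> range (\<lambda>n. - int (Suc n)) = {}" by auto
  ultimately show ?thesis using has_sum_Un_disjoint[OF 1 2] by simp
qed

section \<open>Jacobi's theta series\<close>

definition jacobi_theta :: "complex \<Rightarrow> complex \<Rightarrow> complex" where
  "jacobi_theta \<sigma> v = (\<Sum>\<^sub>\<infinity>s::int. ee (\<sigma> * of_int s ^ 2 / 2 + of_int s * v))"

text \<open>The terms with s \<ge> 0, as a power series in \<open>ee v\<close>. It is entire in that
  variable, which gives holomorphy of the full series in v.\<close>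

definition half_theta :: "complex \<Rightarrow> complex \<Rightarrow> complex" where
  "half_theta \<sigma> = eval_fps (Abs_fps (\<lambda>n. ee (\<sigma> * of_nat n ^ 2 / 2)))"

lemma half_theta_conv_radius:
  assumes "Im \<sigma> > 0"
  shows "fps_conv_radius (Abs_fps (\<lambda>n. ee (\<sigma> * of_nat n ^ 2 / 2))) = \<infinity>"
proof (rule fps_conv_radius_inftyI)
  have "ee (\<sigma> * of_nat (Suc n) ^ 2 / 2) / ee (\<sigma> * of_nat n ^ 2 / 2) = ee (\<sigma> / 2) * ee \<sigma> ^ n" for n
    unfolding ee_diff[symmetric] ee_of_nat_mult[symmetric] ee_add[symmetric]
    by (intro arg_cong[of _ _ ee]) (simp add: power2_eq_square field_simps)
  moreover have "norm (ee \<sigma>) < 1" using assms by (simp add: norm_ee)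
  then have "(\<lambda>n. norm (ee (\<sigma> / 2) * ee \<sigma> ^ n)) \<longlonglongrightarrow> norm (ee (\<sigma> / 2) * 0)"
    by (intro tendsto_intros LIMSEQ_power_zero)
  ultimately show "(\<lambda>n. norm (ee (\<sigma> * of_nat (Suc n) ^ 2 / 2) / ee (\<sigma> * of_nat n ^ 2 / 2))) \<longlonglongrightarrow> 0"
    by simp
qed simp

lemma half_theta_holomorphic:
  "Im \<sigma> > 0 \<Longrightarrow> half_theta \<sigma> holomorphic_on A"
  unfolding half_theta_def by (intro holomorphic_on_eval_fps) (simp add: half_theta_conv_radius)

lemma half_theta_0: "half_theta \<sigma> 0 = 1"
  by (simp add: half_theta_def eval_fps_at_0)

lemma half_theta_summable:
  assumes "Im \<sigma> > 0"
  shows "summable (\<lambda>n. norm (ee (\<sigma> * of_nat n ^ 2 / 2) * x ^ n))"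
  using abs_summable_in_conv_radius[of x "\<lambda>n. ee (\<sigma> * of_nat n ^ 2 / 2)"]
    half_theta_conv_radius[OF assms] by (simp add: fps_conv_radius_def)

lemma half_theta_sums:
  assumes "Im \<sigma> > 0"
  shows "(\<lambda>n. ee (\<sigma> * of_nat n ^ 2 / 2) * x ^ n) sums half_theta \<sigma> x"
  using sums_eval_fps[of x "Abs_fps (\<lambda>n. ee (\<sigma> * of_nat n ^ 2 / 2))"]
    half_theta_conv_radius[OF assms] by (simp add: half_theta_def)

text \<open>The term s = 0 occurs in both halves, hence the - 1.\<close>

lemma jacobi_theta_eq_half_theta:
  assumes "Im \<sigma> > 0"
  shows "jacobi_theta \<sigma> v = half_theta \<sigma> (ee v) + half_theta \<sigma> (ee (- v)) - 1"
proof -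
  let ?t = "\<lambda>x n. ee (\<sigma> * of_nat n ^ 2 / 2) * x ^ n"
  have "((\<lambda>n. ?t (ee v) n) has_sum half_theta \<sigma> (ee v)) UNIV"
    by (rule norm_summable_imp_has_sum[OF half_theta_summable[OF assms] half_theta_sums[OF assms]])
  then have 1: "((\<lambda>n. ee (\<sigma> * of_int (int n) ^ 2 / 2 + of_int (int n) * v)) has_sum half_theta \<sigma> (ee v)) UNIV"
    by (simp add: ee_add ee_of_nat_mult)
  have "(\<lambda>n. ?t (ee (- v)) (Suc n)) sums (half_theta \<sigma> (ee (- v)) - 1)"
    using half_theta_sums[OF assms, of "ee (- v)"] by (subst sums_Suc_iff) simp
  moreover have "summable (\<lambda>n. norm (?t (ee (- v)) (Suc n)))"
    using half_theta_summable[OF assms] by (subst summable_Suc_iff)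
  ultimately have "((\<lambda>n. ?t (ee (- v)) (Suc n)) has_sum (half_theta \<sigma> (ee (- v)) - 1)) UNIV"
    by (intro norm_summable_imp_has_sum)
  moreover have "?t (ee (- v)) (Suc n) =
      ee (\<sigma> * of_int (- int (Suc n)) ^ 2 / 2 + of_int (- int (Suc n)) * v)" for n
    unfolding ee_of_nat_mult[symmetric] ee_add[symmetric]
    by (rule arg_cong[of _ _ ee]) (simp add: power2_eq_square algebra_simps)
  ultimately have "((\<lambda>n. ee (\<sigma> * of_int (- int (Suc n)) ^ 2 / 2 + of_int (- int (Suc n)) * v))
      has_sum (half_theta \<sigma> (ee (- v)) - 1)) UNIV"
    by (simp only:)
  from has_sum_int_split[OF 1 this] show ?thesis
    unfolding jacobi_theta_def by (simp add: infsumI algebra_simps)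
qed

lemma jacobi_theta_holomorphic:
  assumes "Im \<sigma> > 0" "f holomorphic_on A"
  shows "(\<lambda>w. jacobi_theta \<sigma> (f w)) holomorphic_on A"
  unfolding jacobi_theta_eq_half_theta[OF assms(1)]
  using assms by (intro holomorphic_intros entire_compose[OF half_theta_holomorphic])

lemma jacobi_theta_plus_int: "jacobi_theta \<sigma> (v + of_int n) = jacobi_theta \<sigma> v"
proof -
  have "ee (of_int s * (v + of_int n)) = ee (of_int s * v)" for s
    using ee_of_int[of "s * n"] by (simp add: distrib_left ee_add)
  then show ?thesis by (simp add: jacobi_theta_def ee_add)
qed

text \<open>The index shift s to s - 1 changes the quadratic exponent by a term linear in s, which
  is absorbed into v.\<close>

lemma jacobi_theta_minus_period:
  "jacobi_theta \<sigma> (v - \<sigma>) = ee (v - \<sigma> / 2) * jacobi_theta \<sigma> v"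
proof -
  have "bij_betw (\<lambda>s::int. s - 1) UNIV UNIV"
    by (rule bij_betwI[of _ _ _ "\<lambda>s. s + 1"]) auto
  then have "jacobi_theta \<sigma> v = (\<Sum>\<^sub>\<infinity>s::int. ee (\<sigma> * of_int (s - 1) ^ 2 / 2 + of_int (s - 1) * v))"
    unfolding jacobi_theta_def by (rule infsum_reindex_bij_betw[symmetric])
  then have "ee (v - \<sigma> / 2) * jacobi_theta \<sigma> v =
     (\<Sum>\<^sub>\<infinity>s::int. ee (v - \<sigma> / 2) * ee (\<sigma> * of_int (s - 1) ^ 2 / 2 + of_int (s - 1) * v))"
    by (simp add: infsum_cmult_right')
  also have "\<dots> = jacobi_theta \<sigma> (v - \<sigma>)"
    unfolding jacobi_theta_def ee_add[symmetric]
    by (intro infsum_cong arg_cong[of _ _ ee]) (simp add: power2_eq_square field_simps)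
  finally show ?thesis ..
qed

text \<open>Otherwise \<open>half_theta\<close> would tend to \<open>0\<close> at infinity.\<close>

lemma jacobi_theta_nonzero:
  assumes "Im \<sigma> > 0"
  obtains v where "jacobi_theta \<sigma> v \<noteq> 0"
proof (rule ccontr)
  assume "\<not> thesis"
  then have zero: "jacobi_theta \<sigma> v = 0" for v using that by blast
  have *: "half_theta \<sigma> u = 1 - half_theta \<sigma> (inverse u)" if "u \<noteq> 0" for u
  proof -
    define v where "v = Ln u / (2 * of_real pi * \<i>)"
    have "ee v = u" using that by (simp add: ee_def v_def)
    then show ?thesis
      using zero[of v] jacobi_theta_eq_half_theta[OF assms, of v] by (simp add: ee_minus algebra_simps)
  qed
  have "isCont (half_theta \<sigma>) 0"
    using half_theta_holomorphic[OF assms] by (rule entire_imp_isCont)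
  then have "((\<lambda>u. 1 - half_theta \<sigma> (inverse u)) \<longlongrightarrow> 1 - half_theta \<sigma> 0) at_infinity"
    by (intro tendsto_intros isCont_tendsto_compose[of _ "half_theta \<sigma>"] tendsto_inverse_0)
  moreover have "eventually (\<lambda>u. 1 - half_theta \<sigma> (inverse u) = half_theta \<sigma> u) at_infinity"
    using eventually_not_equal_at_infinity[of 0] by eventually_elim (rule *[symmetric])
  ultimately have "(half_theta \<sigma> \<longlongrightarrow> 1 - half_theta \<sigma> 0) at_infinity"
    by (rule Lim_transform_eventually)
  \<comment> \<open>The limit is 1 - 1 = 0, while the value at 0 is 1.\<close>
  from Liouville_weak[OF half_theta_holomorphic[OF assms] this, of 0]
  show False by (simp add: half_theta_0)
qed

section \<open>The theta function of a vector\<close>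

text \<open>A theta function with characteristic: the sum of ee(\<Omega> n^2 / (2N) - n w) over all
  integers n congruent to m modulo N, with n = m + N s expanded.\<close>

definition gabor_basis :: "nat \<Rightarrow> complex \<Rightarrow> int \<Rightarrow> complex \<Rightarrow> complex" where
  "gabor_basis N \<Omega> m w = ee (\<Omega> * of_int m ^ 2 / (2 * of_nat N) - of_int m * w) *
     jacobi_theta (of_nat N * \<Omega>) (of_int m * \<Omega> - of_nat N * w)"

definition gabor_theta :: "nat \<Rightarrow> complex \<Rightarrow> (int \<Rightarrow> complex) \<Rightarrow> complex \<Rightarrow> complex" where
  "gabor_theta N \<Omega> f w = (\<Sum>m\<in>residues_set N. f m * gabor_basis N \<Omega> m w)"

lemma cnj_periodized_gauss_mod:
  assumes N: "N \<ge> 1"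
  shows "cnj (periodized_gauss N (\<Omega> / of_nat N) (x mod int N)) =
    ee (\<Omega> * of_int x ^ 2 / (2 * of_nat N)) * jacobi_theta (of_nat N * \<Omega>) (of_int x * \<Omega>)"
proof -
  define d where "d = x div int N"
  have x: "x mod int N = x - int N * d"
    by (simp add: d_def minus_mult_div_eq_mod)
  \<comment> \<open>The new index turns the translate x - N d - N s into x + N s', which also
    absorbs the quotient d of the reduction modulo N.\<close>
  have "bij_betw (\<lambda>s::int. - (s + d)) UNIV UNIV"
    by (rule bij_betwI[of _ _ _ "\<lambda>s. - s - d"]) auto
  have "cnj (periodized_gauss N (\<Omega> / of_nat N) (x mod int N)) =
     (\<Sum>\<^sub>\<infinity>s::int. ee (\<Omega> / of_nat N * (of_int (x - int N * d) - of_int s * of_nat N) ^ 2 / 2))"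
    unfolding periodized_gauss_def gauss_def infsum_cnj[symmetric] complex_cnj_cnj ee_def x
    by (intro infsum_cong arg_cong[of _ _ exp]) simp
  also have "\<dots> = (\<Sum>\<^sub>\<infinity>s::int. ee (\<Omega> * of_int x ^ 2 / (2 * of_nat N)) *
      ee (of_nat N * \<Omega> * of_int (- (s + d)) ^ 2 / 2 + of_int (- (s + d)) * (of_int x * \<Omega>)))"
    unfolding ee_add[symmetric]
    using N by (intro infsum_cong arg_cong[of _ _ ee]) (simp add: power2_eq_square field_simps)
  also have "\<dots> = ee (\<Omega> * of_int x ^ 2 / (2 * of_nat N)) * (\<Sum>\<^sub>\<infinity>s::int.
      ee (of_nat N * \<Omega> * of_int (- (s + d)) ^ 2 / 2 + of_int (- (s + d)) * (of_int x * \<Omega>)))"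
    by (rule infsum_cmult_right')
  also have "(\<Sum>\<^sub>\<infinity>s::int.
      ee (of_nat N * \<Omega> * of_int (- (s + d)) ^ 2 / 2 + of_int (- (s + d)) * (of_int x * \<Omega>))) =
      jacobi_theta (of_nat N * \<Omega>) (of_int x * \<Omega>)"
    unfolding jacobi_theta_def by (rule infsum_reindex_bij_betw) fact
  finally show ?thesis .
qed

text \<open>In the exponent of the window at m - k, the cross term - \<Omega> m k / N and the
  modulation - l m / N combine to - m w, and the k^2 term is a factor free of m. The theta series
  does not notice the integer l.\<close>

lemma gabor_transform_periodized_gauss:
  assumes N: "N \<ge> 1"
  shows "gabor_transform N (periodized_gauss N (\<Omega> / of_nat N)) f k l =
    ee (\<Omega> * of_int k ^ 2 / (2 * of_nat N)) *
      gabor_theta N \<Omega> f ((of_int k * \<Omega> + of_int l) / of_nat N)"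
  unfolding gabor_transform_def gabor_theta_def sum_distrib_left
proof (rule sum.cong)
  fix m
  let ?w = "(of_int k * \<Omega> + of_int l) / of_nat N"
  let ?J = "jacobi_theta (of_nat N * \<Omega>) (of_int (m - k) * \<Omega>)"
  have "of_int m * \<Omega> - of_nat N * ?w = of_int (m - k) * \<Omega> + of_int (- l)"
    using N by (simp add: field_simps)
  then have J: "jacobi_theta (of_nat N * \<Omega>) (of_int m * \<Omega> - of_nat N * ?w) = ?J"
    by (simp only: jacobi_theta_plus_int)
  have e: "exp (- (2 * of_real pi * \<i> * of_int (l * m) / of_nat N)) = ee (- (of_int (l * m) / of_nat N))"
    by (simp add: ee_def)
  have "ee (\<Omega> * of_int (m - k) ^ 2 / (2 * of_nat N)) * ee (- (of_int (l * m) / of_nat N)) =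
    ee (\<Omega> * of_int k ^ 2 / (2 * of_nat N)) * ee (\<Omega> * of_int m ^ 2 / (2 * of_nat N) - of_int m * ?w)"
    unfolding ee_add[symmetric] using N
    by (intro arg_cong[of _ _ ee]) (simp add: power2_eq_square field_simps)
  then have "ee (\<Omega> * of_int (m - k) ^ 2 / (2 * of_nat N)) * ee (- (of_int (l * m) / of_nat N)) * (f m * ?J) =
    ee (\<Omega> * of_int k ^ 2 / (2 * of_nat N)) * ee (\<Omega> * of_int m ^ 2 / (2 * of_nat N) - of_int m * ?w) * (f m * ?J)"
    by (rule arg_cong)
  then show "f m * cnj (periodized_gauss N (\<Omega> / of_nat N) ((m - k) mod int N)) *
      exp (- (2 * of_real pi * \<i> * of_int (l * m) / of_nat N)) =
    ee (\<Omega> * of_int k ^ 2 / (2 * of_nat N)) * (f m * gabor_basis N \<Omega> m ?w)"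
    unfolding gabor_basis_def cnj_periodized_gauss_mod[OF N] J e by (simp only: mult_ac)
qed simp

text \<open>The shift by \<Omega> moves the argument of the Jacobi series by exactly one
  quasi-period N \<Omega>. The terms with m cancel, so all basis functions share one
  multiplier.\<close>

lemma gabor_theta_in_theta_space:
  assumes N: "N \<ge> 1" and "Im \<Omega> > 0"
  shows "gabor_theta N \<Omega> f \<in> upper_half_point.theta_space \<Omega> N (ee (- (of_nat N * \<Omega> / 2)))"
proof -
  interpret upper_half_point \<Omega> by unfold_locales fact
  let ?\<sigma> = "of_nat N * \<Omega>"
  have \<sigma>: "Im ?\<sigma> > 0" using assms by simp
  have 1: "gabor_basis N \<Omega> m (w + 1) = gabor_basis N \<Omega> m w" for m w
  proof -
    have "of_int m * \<Omega> - of_nat N * (w + 1) = (of_int m * \<Omega> - of_nat N * w) + of_int (- int N)"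
      by (simp add: algebra_simps)
    then have "jacobi_theta ?\<sigma> (of_int m * \<Omega> - of_nat N * (w + 1)) =
        jacobi_theta ?\<sigma> (of_int m * \<Omega> - of_nat N * w)"
      by (simp only: jacobi_theta_plus_int)
    then show ?thesis
      by (simp add: gabor_basis_def distrib_left ee_diff ee_add)
  qed
  have 2: "gabor_basis N \<Omega> m (w + \<Omega>) = ee (- (?\<sigma> / 2)) * ee (- (of_nat N * w)) * gabor_basis N \<Omega> m w" for m w
  proof -
    let ?v = "of_int m * \<Omega> - of_nat N * w"
    let ?e = "ee (\<Omega> * of_int m ^ 2 / (2 * of_nat N) - of_int m * (w + \<Omega>))"
    have "of_int m * \<Omega> - of_nat N * (w + \<Omega>) = ?v - ?\<sigma>"
      by (simp add: algebra_simps)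
    then have "gabor_basis N \<Omega> m (w + \<Omega>) = ?e * ee (?v - ?\<sigma> / 2) * jacobi_theta ?\<sigma> ?v"
      by (simp only: gabor_basis_def jacobi_theta_minus_period mult.assoc)
    also have "?e * ee (?v - ?\<sigma> / 2) = ee (- (?\<sigma> / 2)) * ee (- (of_nat N * w)) *
        ee (\<Omega> * of_int m ^ 2 / (2 * of_nat N) - of_int m * w)"
      unfolding ee_add[symmetric] by (intro arg_cong[of _ _ ee]) (simp add: algebra_simps)
    finally show ?thesis by (simp add: gabor_basis_def)
  qed
  have "gabor_basis N \<Omega> m holomorphic_on UNIV" for m
    unfolding gabor_basis_def by (intro holomorphic_intros jacobi_theta_holomorphic \<sigma>)
  then show ?thesis
    unfolding theta_space_def gabor_theta_def
    by (auto intro!: holomorphic_intros simp: 1 2 sum_distrib_left mult_ac)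
qed

text \<open>The \<open>gabor_basis N \<Omega> m\<close> are eigenfunctions of the shift by \<open>1/N\<close> with distinct eigenvalues.\<close>

lemma gabor_theta_eq_0D:
  assumes N: "N \<ge> 1" and Im: "Im \<Omega> > 0" and zero: "\<And>w. gabor_theta N \<Omega> f w = 0"
    and r: "r \<in> residues_set N"
  shows "f r = 0"
proof -
  have "Im (of_nat N * \<Omega>) > 0" using N Im by simp
  then obtain v where v: "jacobi_theta (of_nat N * \<Omega>) v \<noteq> 0" by (rule jacobi_theta_nonzero)
  \<comment> \<open>Places the argument of the Jacobi series for the residue r at v.\<close>
  define w where "w = (of_int r * \<Omega> - v) / of_nat N"
  have nz: "gabor_basis N \<Omega> r w \<noteq> 0"
    using v N by (simp add: gabor_basis_def w_def)
  define x where "x m = ee (of_int (r - m) / of_nat N)" for m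
  have shift: "gabor_basis N \<Omega> m (w + of_nat j / of_nat N) =
      ee (- (of_int m * of_nat j / of_nat N)) * gabor_basis N \<Omega> m w" for m j
  proof -
    have "of_int m * \<Omega> - of_nat N * (w + of_nat j / of_nat N) =
        (of_int m * \<Omega> - of_nat N * w) + of_int (- int j)"
      using N by (simp add: algebra_simps)
    then have "jacobi_theta (of_nat N * \<Omega>) (of_int m * \<Omega> - of_nat N * (w + of_nat j / of_nat N)) =
        jacobi_theta (of_nat N * \<Omega>) (of_int m * \<Omega> - of_nat N * w)"
      by (simp only: jacobi_theta_plus_int)
    then show ?thesis
      by (simp add: gabor_basis_def distrib_left ee_diff ee_add ee_minus field_simps)
  qed
  have geo: "(\<Sum>j<N. x m ^ j) = (if m = r then of_nat N else 0)" if "m \<in> residues_set N" for m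
  proof (cases "m = r")
    case False
    have "x m ^ N = ee (of_int (r - m))"
      using N by (simp add: x_def ee_of_nat_mult[symmetric])
    then have "x m ^ N = 1" by (simp only: ee_of_int)
    moreover have "x m \<noteq> 1"
    proof
      assume "x m = 1"
      then obtain z where "of_int (r - m) / of_nat N = (of_int z :: complex)"
        by (auto simp: x_def ee_eq_1_iff elim: Ints_cases)
      then have "of_int (r - m) = (of_int (z * int N) :: complex)"
        using N by (simp add: field_simps)
      then have "r - m = z * int N" by (simp only: of_int_eq_iff)
      moreover have "\<bar>r - m\<bar> < int N" using r that by (auto simp: residues_set_def)
      ultimately have "\<bar>z\<bar> * int N < 1 * int N" by (simp add: abs_mult)
      then have "z = 0" by (simp only: mult_less_cancel_right) auto
      then show False using \<open>r - m = z * int N\<close> False by simp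
    qed
    ultimately show ?thesis using False geometric_sum[of "x m" N] by simp
  qed (simp add: x_def)
  have fin: "finite (residues_set N)" by (simp add: residues_set_def)
  \<comment> \<open>A discrete Fourier sum over the shifts projects onto the eigenspace of the
    residue r.\<close>
  have "0 = (\<Sum>j<N. ee (of_int r * of_nat j / of_nat N) * gabor_theta N \<Omega> f (w + of_nat j / of_nat N))"
    by (simp add: zero)
  also have "\<dots> = (\<Sum>j<N. \<Sum>m\<in>residues_set N. f m * gabor_basis N \<Omega> m w * x m ^ j)"
  proof (intro sum.cong refl)
    fix j
    have "ee (of_int r * of_nat j / of_nat N) * ee (- (of_int m * of_nat j / of_nat N)) = x m ^ j" for m
      unfolding x_def ee_add[symmetric] ee_of_nat_mult[symmetric]
      by (intro arg_cong[of _ _ ee]) (simp add: diff_divide_distrib algebra_simps)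
    then have "ee (of_int r * of_nat j / of_nat N) * (f m * (ee (- (of_int m * of_nat j / of_nat N)) * gabor_basis N \<Omega> m w))
      = f m * gabor_basis N \<Omega> m w * x m ^ j" for m
      by (metis mult.commute mult.left_commute)
    then show "ee (of_int r * of_nat j / of_nat N) * gabor_theta N \<Omega> f (w + of_nat j / of_nat N) =
        (\<Sum>m\<in>residues_set N. f m * gabor_basis N \<Omega> m w * x m ^ j)"
      unfolding gabor_theta_def shift sum_distrib_left by (intro sum.cong refl)
  qed
  also have "\<dots> = (\<Sum>m\<in>residues_set N. f m * gabor_basis N \<Omega> m w * (\<Sum>j<N. x m ^ j))"
    by (subst sum.swap) (simp add: sum_distrib_left)
  also have "\<dots> = (\<Sum>m\<in>residues_set N. if m = r then f m * gabor_basis N \<Omega> m w * of_nat N else 0)"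
    by (intro sum.cong) (auto simp: geo)
  also have "\<dots> = f r * gabor_basis N \<Omega> r w * of_nat N"
    using r fin by simp
  finally show ?thesis using nz N by simp
qed

section \<open>Finite frames and linear algebra\<close>

text \<open>Gaussian elimination: equation i is solved for a variable s with nonzero coefficient and
  substituted into the others, which removes one equation and one unknown.\<close>

lemma underdetermined_system_nontrivial_solution:
  fixes a :: "'j \<Rightarrow> 'r \<Rightarrow> 'a::field"
  assumes "finite J" "finite R" "card J < card R"
  shows "\<exists>f. (\<exists>r\<in>R. f r \<noteq> 0) \<and> (\<forall>j\<in>J. (\<Sum>r\<in>R. a j r * f r) = 0)"
  using assms
proof (induction J arbitrary: R a rule: finite_induct)
  case empty
  then have "R \<noteq> {}" by auto
  then show ?case by (intro exI[of _ "\<lambda>_. 1"]) auto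
next
  case (insert i J)
  show ?case
  proof (cases "\<forall>r\<in>R. a i r = 0")
    case True
    have "card J < card R" using insert by simp
    from insert.IH[OF insert.prems(1) this, of a] show ?thesis
      using True by auto
  next
    case False
    then obtain s where s: "s \<in> R" "a i s \<noteq> 0" by blast
    define b where "b j r = a j r - a j s * a i r / a i s" for j r
    have "finite (R - {s})" "card J < card (R - {s})"
      using insert s by auto
    from insert.IH[OF this, of b] obtain f where f: "\<exists>r\<in>R - {s}. f r \<noteq> 0"
        "\<And>j. j \<in> J \<Longrightarrow> (\<Sum>r\<in>R - {s}. b j r * f r) = 0" by blast
    define x where "x = - (\<Sum>r\<in>R - {s}. a i r * f r) / a i s"
    define g where "g = f(s := x)"
    have eq: "(\<Sum>r\<in>R. a j r * g r) = (\<Sum>r\<in>R - {s}. b j r * f r)" for j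
    proof -
      have "(\<Sum>r\<in>R. a j r * g r) = a j s * x + (\<Sum>r\<in>R - {s}. a j r * f r)"
        using insert.prems(1) s by (simp add: sum.remove[of R s] g_def)
      also have "\<dots> = (\<Sum>r\<in>R - {s}. b j r * f r)"
        by (simp add: x_def b_def algebra_simps sum_subtractf sum_distrib_left sum_divide_distrib)
      finally show ?thesis .
    qed
    have "(\<Sum>r\<in>R. a j r * g r) = 0" if "j \<in> insert i J" for j
      using that f(2) s(2) unfolding eq by (auto simp: b_def)
    moreover have "\<exists>r\<in>R. g r \<noteq> 0" using f(1) by (auto simp: g_def)
    ultimately show ?thesis by blast
  qed
qed

text \<open>If \<open>a i\<close> vanishes on the common kernel of the others, it may be dropped.
  Otherwise some v in that kernel has \<open>a i\<close> nonzero; subtracting the multiple y of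
  \<open>a i\<close> makes b vanish at v, hence on the whole kernel.\<close>

lemma functional_in_span_of_kernel:
  fixes a :: "'j \<Rightarrow> 'r \<Rightarrow> 'a::field" and b :: "'r \<Rightarrow> 'a" and R :: "'r set"
  defines "S \<equiv> \<lambda>b f. (\<Sum>r\<in>R. b r * f r)"
  assumes "finite J" and "\<And>f. (\<And>j. j \<in> J \<Longrightarrow> S (a j) f = 0) \<Longrightarrow> S b f = 0"
  shows "\<exists>c. \<forall>f. S b f = (\<Sum>j\<in>J. c j * S (a j) f)"
  using assms(2,3)
proof (induction J arbitrary: b rule: finite_induct)
  case empty
  then show ?case by simp
next
  case (insert i J)
  have lin: "S (\<lambda>r. b r - x * b' r) f = S b f - x * S b' f"
      "S b (\<lambda>r. f r - x * f' r) = S b f - x * S b f'" for b b' f f' x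
    by (simp_all add: S_def algebra_simps sum_subtractf sum_distrib_left)
  show ?case
  proof (cases "\<exists>v. (\<forall>j\<in>J. S (a j) v = 0) \<and> S (a i) v \<noteq> 0")
    case False
    then have "S b f = 0" if "\<And>j. j \<in> J \<Longrightarrow> S (a j) f = 0" for f
      using that insert.prems by blast
    from insert.IH[OF this] obtain c where c: "\<And>f. S b f = (\<Sum>j\<in>J. c j * S (a j) f)" by blast
    have "S b f = (\<Sum>j\<in>insert i J. (c(i := 0)) j * S (a j) f)" for f
      using insert.hyps c by (simp, intro sum.cong) auto
    then show ?thesis by blast
  next
    case True
    then obtain v where v: "\<And>j. j \<in> J \<Longrightarrow> S (a j) v = 0" "S (a i) v \<noteq> 0" by blast
    define y where "y = S b v / S (a i) v"
    have "S (\<lambda>r. b r - y * a i r) f = 0" if f: "\<And>j. j \<in> J \<Longrightarrow> S (a j) f = 0" for f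
    proof -
      define x where "x = S (a i) f / S (a i) v"
      have "S b (\<lambda>r. f r - x * v r) = 0"
      proof (rule insert.prems, unfold lin)
        show "S (a j) f - x * S (a j) v = 0" if "j \<in> insert i J" for j
          using that v f by (auto simp: x_def)
      qed
      then have "S b f - x * S b v = 0" unfolding lin .
      then show ?thesis unfolding lin by (simp add: x_def y_def)
    qed
    from insert.IH[OF this] obtain c where
      c: "\<And>f. S (\<lambda>r. b r - y * a i r) f = (\<Sum>j\<in>J. c j * S (a j) f)" by blast
    have "S b f = (\<Sum>j\<in>insert i J. (c(i := y)) j * S (a j) f)" for f
    proof -
      have "(\<Sum>j\<in>J. (c(i := y)) j * S (a j) f) = (\<Sum>j\<in>J. c j * S (a j) f)"
        using insert.hyps by (intro sum.cong) auto
      then show ?thesis using insert.hyps c[of f] by (simp add: lin algebra_simps)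
    qed
    then show ?thesis by blast
  qed
qed

lemma norm_sum_mult_squared_le:
  fixes a f :: "'r \<Rightarrow> complex"
  shows "(cmod (\<Sum>r\<in>R. a r * f r))\<^sup>2 \<le> (\<Sum>r\<in>R. (cmod (a r))\<^sup>2) * (\<Sum>r\<in>R. (cmod (f r))\<^sup>2)"
proof -
  have "cmod (\<Sum>r\<in>R. a r * f r) \<le> (\<Sum>r\<in>R. cmod (a r) * cmod (f r))"
    using norm_sum[of "\<lambda>r. a r * f r" R] by (simp add: norm_mult)
  then have "(cmod (\<Sum>r\<in>R. a r * f r))\<^sup>2 \<le> (\<Sum>r\<in>R. cmod (a r) * cmod (f r))\<^sup>2"
    by (rule power_mono) simp
  also have "\<dots> \<le> (\<Sum>r\<in>R. (cmod (a r))\<^sup>2) * (\<Sum>r\<in>R. (cmod (f r))\<^sup>2)"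
    by (rule Cauchy_Schwarz_ineq_sum)
  finally show ?thesis .
qed

lemma finite_residues_set [simp]: "finite (residues_set N)"
  by (simp add: residues_set_def)

lemma card_residues_set [simp]: "card (residues_set N) = N"
  by (simp add: residues_set_def)

lemma vec_norm_squared: "(vec_norm N f)\<^sup>2 = (\<Sum>m\<in>residues_set N. (cmod (f m))\<^sup>2)"
  by (simp add: vec_norm_def L2_set_def sum_nonneg)

definition gabor_atom :: "nat \<Rightarrow> (int \<Rightarrow> complex) \<Rightarrow> int \<Rightarrow> int \<Rightarrow> int \<Rightarrow> complex" where
  "gabor_atom N g k l m =
     cnj (g ((m - k) mod int N)) * exp (- (2 * of_real pi * \<i> * of_int (l * m) / of_nat N))"

lemma gabor_transform_eq_atom:
  "gabor_transform N g f k l = (\<Sum>m\<in>residues_set N. gabor_atom N g k l m * f m)"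
  by (simp add: gabor_transform_def gabor_atom_def mult_ac)

text \<open>By injectivity each coordinate of f is a fixed linear combination of the coefficients,
  so Cauchy-Schwarz gives an explicit lower bound, without a compactness argument. The upper bound
  is Cauchy-Schwarz against the atoms.\<close>

lemma induces_gabor_frame_iff_injective:
  "induces_gabor_frame N g K k l \<longleftrightarrow>
     (\<forall>f. (\<forall>j\<in>{1..K}. gabor_transform N g f (k j) (l j) = 0) \<longrightarrow> (\<forall>m\<in>residues_set N. f m = 0))"
  (is "?L \<longleftrightarrow> ?R")
proof
  assume ?L
  then obtain A where A: "A > 0" "\<And>f. A * (vec_norm N f)\<^sup>2 \<le>
      (\<Sum>j=1..K. (cmod (gabor_transform N g f (k j) (l j)))\<^sup>2)"
    unfolding induces_gabor_frame_def by blast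
  show ?R
  proof (intro allI impI ballI)
    fix f m
    assume z: "\<forall>j\<in>{1..K}. gabor_transform N g f (k j) (l j) = 0" and m: "m \<in> residues_set N"
    have "A * (vec_norm N f)\<^sup>2 \<le> 0" using A(2)[of f] z by simp
    then have "(vec_norm N f)\<^sup>2 = 0"
      using A(1) by (metis mult_le_0_iff not_less order_antisym zero_le_power2)
    then show "f m = 0"
      using m unfolding vec_norm_squared by (subst (asm) sum_nonneg_eq_0_iff) auto
  qed
next
  assume inj: ?R
  let ?T = "\<lambda>f j. gabor_transform N g f (k j) (l j)"
  have "\<exists>c. \<forall>f. f m = (\<Sum>j\<in>{1..K}. c j * ?T f j)" if m: "m \<in> residues_set N" for m
  proof -
    have coord: "(\<Sum>r\<in>residues_set N. of_bool (r = m) * f r) = f m" for f :: "int \<Rightarrow> complex"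
      using m by (simp add: of_bool_def if_distrib[of "\<lambda>x. x * _"] cong: if_cong)
    show ?thesis
      using functional_in_span_of_kernel[where J = "{1..K}" and R = "residues_set N"
          and a = "\<lambda>j. gabor_atom N g (k j) (l j)" and b = "\<lambda>r. of_bool (r = m)"] inj m
      unfolding coord gabor_transform_eq_atom by blast
  qed
  then obtain c where c: "\<And>m f. m \<in> residues_set N \<Longrightarrow> f m = (\<Sum>j\<in>{1..K}. c m j * ?T f j)"
    by metis
  define C where "C = (\<Sum>m\<in>residues_set N. \<Sum>j=1..K. (cmod (c m j))\<^sup>2)"
  define D where "D = (\<Sum>j=1..K. \<Sum>m\<in>residues_set N. (cmod (gabor_atom N g (k j) (l j) m))\<^sup>2)"
  have C: "C \<ge> 0" and D: "D \<ge> 0" by (auto simp: C_def D_def intro!: sum_nonneg)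
  have lower: "(vec_norm N f)\<^sup>2 \<le> C * (\<Sum>j=1..K. (cmod (?T f j))\<^sup>2)" for f
    unfolding vec_norm_squared C_def sum_distrib_right
  proof (rule sum_mono)
    fix m assume "m \<in> residues_set N"
    from c[OF this, of f] norm_sum_mult_squared_le[of "c m" "?T f" "{1..K}"]
    show "(cmod (f m))\<^sup>2 \<le> (\<Sum>n=1..K. (cmod (c m n))\<^sup>2 * (\<Sum>j=1..K. (cmod (?T f j))\<^sup>2))"
      by (simp add: sum_distrib_right)
  qed
  have upper: "(\<Sum>j=1..K. (cmod (?T f j))\<^sup>2) \<le> D * (vec_norm N f)\<^sup>2" for f
    unfolding D_def sum_distrib_right[of _ "{1..K}"] vec_norm_squared gabor_transform_eq_atom
    by (intro sum_mono norm_sum_mult_squared_le)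
  show ?L
    unfolding induces_gabor_frame_def
  proof (intro exI conjI allI)
    \<comment> \<open>C and D are only known to be nonnegative; adding 1 makes the frame bounds
      positive.\<close>
    show "1 / (C + 1) > 0" "D + 1 > 0" using C D by auto
    fix f
    have "(vec_norm N f)\<^sup>2 \<le> (C + 1) * (\<Sum>j=1..K. (cmod (?T f j))\<^sup>2)"
      using lower[of f] sum_nonneg[of "{1..K}" "\<lambda>j. (cmod (?T f j))\<^sup>2"] by (simp add: distrib_right)
    then show "1 / (C + 1) * (vec_norm N f)\<^sup>2 \<le> (\<Sum>j=1..K. (cmod (?T f j))\<^sup>2)"
      using C by (simp add: divide_le_eq mult.commute)
    show "(\<Sum>j=1..K. (cmod (?T f j))\<^sup>2) \<le> (D + 1) * (vec_norm N f)\<^sup>2"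
      using upper[of f] by (simp add: distrib_right add_increasing2)
  qed
qed

text \<open>The terms with \<open>Re \<Omega>\<close> cancel; \<open>N / 2\<close> is summed \<open>N\<close> times, which decides the parity of \<open>N\<close>.\<close>

lemma divisibility_condition_iff:
  assumes N: "N \<ge> 1"
  shows "divisibility_condition N \<Omega> k l \<longleftrightarrow>
    even N \<and> int N dvd (\<Sum>j=1..N. k j) \<and> int N dvd (\<Sum>j=1..N. l j)"
proof -
  define A where "A k z = (\<Sum>j=1..N. (of_int (k j) - real N / 2 + of_int z))" for k :: "nat \<Rightarrow> int" and z :: int
  have A: "A k z = of_int (\<Sum>j=1..N. k j) - real N * real N / 2 + real N * of_int z" for k z
    by (simp add: A_def sum.distrib sum_subtractf)
  have cond: "divisibility_condition N \<Omega> k l \<longleftrightarrow>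
      (\<forall>z1 z3 z4 :: int. \<exists>q::int. of_int z4 * A k z1 - of_int z3 * A l z1 = of_int q * real N)"
    unfolding divisibility_condition_def A_def[symmetric] by (simp add: algebra_simps)
  have single: "even N \<and> int N dvd s" if "of_int s - real N * real N / 2 = of_int q * real N" for s q :: int
  proof -
    have "of_int (2 * s) = (of_int (2 * q * int N + int N * int N) :: real)"
      using that by (simp add: field_simps)
    then have *: "2 * s = 2 * q * int N + int N * int N" by (simp only: of_int_eq_iff)
    then have "int N * int N = 2 * (s - q * int N)" by (simp add: algebra_simps)
    then have "even (int N * int N)" by (metis dvd_triv_left)
    then have "even N" by simp
    then obtain M where M: "N = 2 * M" by blast
    have "s = int N * (q + int M)"
      using * unfolding M by (simp add: algebra_simps)
    then show ?thesis using \<open>even N\<close> by simp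
  qed
  show ?thesis
  proof
    assume "divisibility_condition N \<Omega> k l"
    note * = this[unfolded cond, rule_format]
    \<comment> \<open>The instances z4 = 1, z3 = 0 and z4 = 0, z3 = -1, both with z1 = 0, isolate
      the sums over k and l.\<close>
    show "even N \<and> int N dvd (\<Sum>j=1..N. k j) \<and> int N dvd (\<Sum>j=1..N. l j)"
      using *[of 1 0 0] *[of 0 0 "-1"] single[of "\<Sum>j=1..N. k j"] single[of "\<Sum>j=1..N. l j"]
      by (auto simp: A simp del: of_int_sum)
  next
    assume "even N \<and> int N dvd (\<Sum>j=1..N. k j) \<and> int N dvd (\<Sum>j=1..N. l j)"
    then obtain M x y where *: "N = 2 * M" "(\<Sum>j=1..N. k j) = int N * x" "(\<Sum>j=1..N. l j) = int N * y"
      by (elim conjE dvdE) blast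
    have AB: "A k z = of_int (x - int M + z) * real N" "A l z = of_int (y - int M + z) * real N" for z
      unfolding A *(2,3) by (simp_all add: *(1) algebra_simps)
    have "of_int z4 * A k z1 - of_int z3 * A l z1 =
        of_int (z4 * (x - int M + z1) - z3 * (y - int M + z1)) * real N" for z1 z3 z4 :: int
      unfolding AB by (simp add: algebra_simps)
    then show "divisibility_condition N \<Omega> k l" unfolding cond by blast
  qed
qed

lemma nat_multiples_iff: "x \<in> nat_multiples N \<longleftrightarrow> x \<ge> 0 \<and> int N dvd x"
proof
  assume "x \<ge> 0 \<and> int N dvd x"
  then have "x = int (nat x)" "N dvd nat x" by (auto simp: nat_dvd_iff int_dvd_int_iff[symmetric])
  then show "x \<in> nat_multiples N" unfolding nat_multiples_def by (metis dvdE rangeI)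
qed (auto simp: nat_multiples_def)

lemma sum_Pair: "(\<Sum>j\<in>J. (k j, l j)) = (sum k J, sum l J)"
  by (simp add: prod_eq_iff fst_sum snd_sum)

section \<open>Frames from lattice points\<close>

text \<open>These are the N-torsion points of the torus, one for each pair of residues.\<close>

definition gabor_point :: "nat \<Rightarrow> complex \<Rightarrow> int \<Rightarrow> int \<Rightarrow> complex" where
  "gabor_point N \<Omega> k l = (of_int k * \<Omega> + of_int l) / of_nat N"

lemma gabor_transform_eq_0_iff:
  assumes "N \<ge> 1"
  shows "gabor_transform N (periodized_gauss N (\<Omega> / of_nat N)) f k l = 0 \<longleftrightarrow>
    gabor_theta N \<Omega> f (gabor_point N \<Omega> k l) = 0"
  using gabor_transform_periodized_gauss[OF assms] by (simp add: gabor_point_def)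

context upper_half_point
begin

lemma gabor_point_distinct_mod_lattice:
  assumes N: "N \<ge> 1" and in_range: "(k, l) \<in> residues_set N \<times> residues_set N"
    "(k', l') \<in> residues_set N \<times> residues_set N"
    and diff: "gabor_point N \<tau> k l - gabor_point N \<tau> k' l' \<in> lattice"
  shows "(k, l) = (k', l')"
proof -
  obtain m n where "gabor_point N \<tau> k l - gabor_point N \<tau> k' l' = of_int m + of_int n * \<tau>"
    using diff by (auto simp: lattice_def)
  moreover have "gabor_point N \<tau> k l - gabor_point N \<tau> k' l' =
      (of_int (k - k') * \<tau> + of_int (l - l')) / of_nat N"
    by (simp add: gabor_point_def diff_divide_distrib[symmetric] algebra_simps)
  ultimately have "of_int (k - k') * \<tau> + of_int (l - l') = (of_int m + of_int n * \<tau>) * of_nat N"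
    using N by (simp add: nonzero_divide_eq_eq)
  then have "of_int (k - k' - int N * n) * \<tau> = of_int (l' - l + int N * m)"
    by (simp add: algebra_simps)
  moreover from this have "Im (of_int (k - k' - int N * n) * \<tau>) = Im (of_int (l' - l + int N * m))"
    by (rule arg_cong)
  then have "of_int (k - k' - int N * n) * Im \<tau> = 0" by simp
  then have 1: "k - k' - int N * n = 0"
    using Im_pos by (metis mult_eq_0_iff of_int_eq_0_iff less_irrefl)
  ultimately have "(of_int (l' - l + int N * m) :: complex) = 0" by simp
  then have 2: "l' - l + int N * m = 0" by (simp only: of_int_eq_0_iff)
  have "k mod int N = k' mod int N" "l mod int N = l' mod int N"
    using 1 2 by (auto simp: mod_eq_dvd_iff dvd_def algebra_simps intro: exI[of _ n] exI[of _ m])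
  then show ?thesis using in_range by (simp add: residues_set_def)
qed

text \<open>The arithmetic condition is Abel's condition on the points \<open>w j\<close>, for the
  multiplier \<open>c\<close>, read in the real coordinates along 1 and \<tau>.\<close>

lemma gabor_frame_critical_iff:
  fixes k l :: "nat \<Rightarrow> int"
  assumes N: "N \<ge> 1"
    and in_range: "\<And>j. j \<in> {1..N} \<Longrightarrow> (k j, l j) \<in> residues_set N \<times> residues_set N"
    and inj: "inj_on (\<lambda>j. (k j, l j)) {1..N}"
  shows "induces_gabor_frame N (periodized_gauss N (\<tau> / of_nat N)) N k l \<longleftrightarrow>
    \<not> (even N \<and> int N dvd (\<Sum>j=1..N. k j) \<and> int N dvd (\<Sum>j=1..N. l j))"
proof -
  define w where "w j = gabor_point N \<tau> (k j) (l j)" for j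
  define c where "c = ee (- (of_nat N * \<tau> / 2))"
  have dist: "w i - w j \<notin> lattice" if "i \<in> {1..N}" "j \<in> {1..N}" "i \<noteq> j" for i j
    using gabor_point_distinct_mod_lattice[OF N in_range[OF that(1)] in_range[OF that(2)]]
      inj_onD[OF inj _ that(1,2)] that(3) unfolding w_def by blast
  have Th: "gabor_theta N \<tau> f \<in> theta_space N c" for f
    unfolding c_def by (rule gabor_theta_in_theta_space[OF N Im_pos])
  have sum_w: "(\<Sum>j=1..N. w j) = (of_int (\<Sum>j=1..N. k j) * \<tau> + of_int (\<Sum>j=1..N. l j)) / of_nat N"
    by (simp add: w_def gabor_point_def sum_divide_distrib[symmetric] sum.distrib sum_distrib_right)
  have frame: "induces_gabor_frame N (periodized_gauss N (\<tau> / of_nat N)) N k l \<longleftrightarrow>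
    (\<forall>f. (\<forall>j\<in>{1..N}. gabor_theta N \<tau> f (w j) = 0) \<longrightarrow> (\<forall>m\<in>residues_set N. f m = 0))"
    unfolding induces_gabor_frame_iff_injective gabor_transform_eq_0_iff[OF N] w_def ..
  show ?thesis
  proof (intro iffI notI)
    assume "induces_gabor_frame N (periodized_gauss N (\<tau> / of_nat N)) N k l"
      and "even N \<and> int N dvd (\<Sum>j=1..N. k j) \<and> int N dvd (\<Sum>j=1..N. l j)"
    then obtain M x y where *: "N = 2 * M" "(\<Sum>j=1..N. k j) = int N * x" "(\<Sum>j=1..N. l j) = int N * y"
      by (elim conjE dvdE) blast
    \<comment> \<open>Leaving out the index N gives N - 1 homogeneous equations in N
      unknowns.\<close>
    define J where "J = {1..N - 1}"
    have J: "finite J" "{1..N} = insert N J" "N \<notin> J" "card J = N - 1" "J \<subseteq> {1..N}"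
      using N by (auto simp: J_def)
    have "card J < card (residues_set N)" using N J by simp
    from underdetermined_system_nontrivial_solution[OF J(1) finite_residues_set this,
        of "\<lambda>j m. gabor_basis N \<tau> m (w j)"]
    obtain f m where f: "m \<in> residues_set N" "f m \<noteq> 0" "\<And>j. j \<in> J \<Longrightarrow> gabor_theta N \<tau> f (w j) = 0"
      by (auto simp: gabor_theta_def mult.commute)
    have "gabor_theta N \<tau> f \<in> theta_space (1 + card J) c" using Th N J(4) by simp
    then obtain G where G: "G \<in> theta_space 1 (c * ee (of_nat (card J) / 2 - (\<Sum>j\<in>J. w j)))"
        "\<And>z. gabor_theta N \<tau> f z = (\<Prod>j\<in>J. lattice_theta (z - w j)) * G z"
      using theta_space_divide_prod[where J = J and F = "gabor_theta N \<tau> f" and M = 1 and c = c and a = w]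
        J f(3) dist by (auto simp: c_def)
    have "G (w N) = 0"
    proof (rule theta_space_1_zero[OF G(1)])
      have "(\<Sum>j=1..N. w j) = of_int x * \<tau> + of_int y"
        unfolding sum_w *(2,3) using N by (simp add: field_simps)
      then have sumJ: "(\<Sum>j\<in>J. w j) = of_int x * \<tau> + of_int y - w N"
        using J by (simp add: algebra_simps)
      \<comment> \<open>With N = 2 M one has (N - 1) / 2 = (M - 1) + 1/2; the half supplies the sign
        that the degree 1 case requires.\<close>
      have "c * ee (of_nat (card J) / 2 - (\<Sum>j\<in>J. w j)) =
          ee (w N + of_int (- int M - x) * \<tau> + of_int (int M - 1 - y) + 1 / 2)"
        unfolding c_def ee_add[symmetric] sumJ J(4) using N
        by (intro arg_cong[of _ _ ee]) (simp add: of_nat_diff *(1) field_simps)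
      then show "c * ee (of_nat (card J) / 2 - (\<Sum>j\<in>J. w j)) = - ee (w N + of_int (- int M - x) * \<tau>)"
        by (simp only: ee_add ee_of_int ee_half) simp
    qed
    then have "gabor_theta N \<tau> f (w N) = 0" by (simp add: G(2))
    with f(3) have "gabor_theta N \<tau> f (w j) = 0" if "j \<in> {1..N}" for j
      using that unfolding J(2) by blast
    with frame \<open>induces_gabor_frame _ _ _ _ _\<close> f(1,2) show False by blast
  next
    assume no: "\<not> (even N \<and> int N dvd (\<Sum>j=1..N. k j) \<and> int N dvd (\<Sum>j=1..N. l j))"
    show "induces_gabor_frame N (periodized_gauss N (\<tau> / of_nat N)) N k l"
    proof (subst frame, intro allI impI ballI, rule ccontr)
      fix f m
      assume f: "\<forall>j\<in>{1..N}. gabor_theta N \<tau> f (w j) = 0" "m \<in> residues_set N" "f m \<noteq> 0"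
      then obtain w0 where w0: "gabor_theta N \<tau> f w0 \<noteq> 0"
        using gabor_theta_eq_0D[OF N Im_pos] by blast
      have "gabor_theta N \<tau> f \<in> theta_space (card {1..N}) c" using Th by simp
      then obtain n :: int where
        "c * ee (of_nat (card {1..N}) / 2 - (\<Sum>j=1..N. w j)) = ee (of_int n * \<tau>)"
        using theta_space_zeros(1)[of "{1..N}" "gabor_theta N \<tau> f" c w w0] f(1) w0 dist
        by (auto simp: c_def)
      then have "ee (- (of_nat N * \<tau> / 2) + (of_nat N / 2 - (\<Sum>j=1..N. w j)) - of_int n * \<tau>) = 1"
        unfolding c_def ee_diff[of _ "of_int n * \<tau>"] ee_add by simp
      then obtain z :: int where
        z: "- (of_nat N * \<tau> / 2) + (of_nat N / 2 - (\<Sum>j=1..N. w j)) - of_int n * \<tau> = of_int z"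
        by (auto simp: ee_eq_1_iff elim: Ints_cases)
      \<comment> \<open>Clearing the denominator 2 N leaves integers as coefficients of 1 and
        \<tau>; the imaginary part then separates the two.\<close>
      have "of_nat N * (2 * (\<Sum>j=1..N. w j)) =
          2 * (of_int (\<Sum>j=1..N. k j) * \<tau> + of_int (\<Sum>j=1..N. l j))"
        unfolding sum_w using N by (simp del: of_int_sum)
      moreover have "2 * of_nat N * (- (of_nat N * \<tau> / 2) + (of_nat N / 2 - (\<Sum>j=1..N. w j)) - of_int n * \<tau>) =
          2 * of_nat N * of_int z" by (simp only: z)
      ultimately have eq: "of_int (int N * int N + 2 * (\<Sum>j=1..N. k j) + 2 * int N * n) * \<tau> =
          of_int (int N * int N - 2 * (\<Sum>j=1..N. l j) - 2 * int N * z)"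
        by (simp add: algebra_simps del: of_int_sum)
      then have "Im (of_int (int N * int N + 2 * (\<Sum>j=1..N. k j) + 2 * int N * n) * \<tau>) =
          Im (of_int (int N * int N - 2 * (\<Sum>j=1..N. l j) - 2 * int N * z))"
        by (rule arg_cong)
      then have "of_int (int N * int N + 2 * (\<Sum>j=1..N. k j) + 2 * int N * n) * Im \<tau> = 0"
        by (simp del: of_int_sum)
      then have 1: "int N * int N + 2 * (\<Sum>j=1..N. k j) + 2 * int N * n = 0"
        using Im_pos by (metis mult_eq_0_iff of_int_eq_0_iff less_irrefl)
      with eq have "(of_int (int N * int N - 2 * (\<Sum>j=1..N. l j) - 2 * int N * z) :: complex) = 0"
        by (simp del: of_int_sum of_int_add of_int_mult of_int_diff)
      then have 2: "int N * int N - 2 * (\<Sum>j=1..N. l j) - 2 * int N * z = 0"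
        by (simp only: of_int_eq_0_iff)
      have "int N * int N = 2 * ((\<Sum>j=1..N. l j) + int N * z)" using 2 by (simp add: algebra_simps)
      then have "even (int N * int N)" by (metis dvd_triv_left)
      then have "even N" by simp
      then obtain M where M: "N = 2 * M" by blast
      have "(\<Sum>j=1..N. k j) = int N * (- int M - n)" "(\<Sum>j=1..N. l j) = int N * (int M - z)"
        using 1 2 by (simp_all add: M algebra_simps)
      then show False using no \<open>even N\<close> by simp
    qed
  qed
qed

text \<open>For a vector in the kernel, the first N points exhaust the zeros modulo the lattice, but
  the K-th point is a further inequivalent one.\<close>

lemma gabor_frame_oversampled:
  fixes k l :: "nat \<Rightarrow> int"
  assumes N: "N \<ge> 1" and "K > N"
    and in_range: "\<And>j. j \<in> {1..K} \<Longrightarrow> (k j, l j) \<in> residues_set N \<times> residues_set N"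
    and inj: "inj_on (\<lambda>j. (k j, l j)) {1..K}"
  shows "induces_gabor_frame N (periodized_gauss N (\<tau> / of_nat N)) K k l"
  unfolding induces_gabor_frame_iff_injective gabor_transform_eq_0_iff[OF N]
proof (intro allI impI ballI, rule ccontr)
  fix f m
  define w where "w j = gabor_point N \<tau> (k j) (l j)" for j
  assume f: "\<forall>j\<in>{1..K}. gabor_theta N \<tau> f (gabor_point N \<tau> (k j) (l j)) = 0"
    "m \<in> residues_set N" "f m \<noteq> 0"
  have dist: "w i - w j \<notin> lattice" if "i \<in> {1..K}" "j \<in> {1..K}" "i \<noteq> j" for i j
    using gabor_point_distinct_mod_lattice[OF N in_range[OF that(1)] in_range[OF that(2)]]
      inj_onD[OF inj _ that(1,2)] that(3) unfolding w_def by blast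
  obtain w0 where w0: "gabor_theta N \<tau> f w0 \<noteq> 0"
    using f gabor_theta_eq_0D[OF N Im_pos] by blast
  have "gabor_theta N \<tau> f \<in> theta_space (card {1..N}) (ee (- (of_nat N * \<tau> / 2)))"
    using gabor_theta_in_theta_space[OF N Im_pos] by simp
  then have "\<exists>j\<in>{1..N}. w K - w j \<in> lattice"
    using theta_space_zeros(2)[of "{1..N}" "gabor_theta N \<tau> f" "ee (- (of_nat N * \<tau> / 2))" w w0 "w K"] f(1) w0 dist \<open>K > N\<close>
    by (auto simp: w_def)
  then show False using dist[of K] \<open>K > N\<close> by force
qed

end

lemma not_gabor_frame_undersampled:
  assumes "K < N"
  shows "\<not> induces_gabor_frame N g K k l"
proof -
  have "card {1..K} < card (residues_set N)" using assms by simp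
  from underdetermined_system_nontrivial_solution[OF finite_atLeastAtMost finite_residues_set this,
      of "\<lambda>j. gabor_atom N g (k j) (l j)"]
  show ?thesis
    unfolding induces_gabor_frame_iff_injective gabor_transform_eq_atom by blast
qed

theorem theorem1p2:
  fixes N K :: nat and \<Omega> :: complex and k l :: "nat \<Rightarrow> int"
  assumes "N \<ge> 1"
    and "Im \<Omega> > 0"
    and "\<And>j. j \<in> {1..K} \<Longrightarrow> (k j, l j) \<in> residues_set N \<times> residues_set N"
    and "inj_on (\<lambda>j. (k j, l j)) {1..K}"
  shows
    "(K > N \<longrightarrow> induces_gabor_frame N (periodized_gauss N (\<Omega> / of_nat N)) K k l) \<and>
     (K < N \<longrightarrow> \<not> induces_gabor_frame N (periodized_gauss N (\<Omega> / of_nat N)) K k l) \<and>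
     (K = N \<longrightarrow>
        (induces_gabor_frame N (periodized_gauss N (\<Omega> / of_nat N)) K k l
           \<longleftrightarrow> \<not> divisibility_condition N \<Omega> k l) \<and>
        (Re \<Omega> = 0 \<longrightarrow>
           (divisibility_condition N \<Omega> k l
              \<longleftrightarrow> even N \<and> (\<Sum>j=1..N. (k j, l j)) \<in> nat_multiples N \<times> nat_multiples N)))"
proof -
  interpret upper_half_point \<Omega> by unfold_locales fact
  have "divisibility_condition N \<Omega> k l
      \<longleftrightarrow> even N \<and> (\<Sum>j=1..N. (k j, l j)) \<in> nat_multiples N \<times> nat_multiples N" if "K = N"
  proof -
    \<comment> \<open>Sums of residues are nonnegative, so divisibility by N already means being a
      multiple by a natural number.\<close>
    have "(\<Sum>j=1..N. k j) \<ge> 0" "(\<Sum>j=1..N. l j) \<ge> 0"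
      using assms(3) that by (auto simp: residues_set_def intro!: sum_nonneg)
    then show ?thesis
      by (simp add: divisibility_condition_iff[OF assms(1)] sum_Pair nat_multiples_iff)
  qed
  then show ?thesis
    using gabor_frame_oversampled[OF assms(1)] not_gabor_frame_undersampled assms
      gabor_frame_critical_iff[OF assms(1)] divisibility_condition_iff[OF assms(1)]
    by auto
qed

end
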